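(* Let $m\in\mathbb{N}_0$, $\lambda'\in(0,\infty)$, $\mu,\mu'\in(0,\infty)$ with $\mu\neq\mu'$, and $k\in(0,\infty)$. Then \[ \int_0^\infty Q_{m-1/2}(\chi)\,J_m(k\lambda)\sqrt{\lambda}\,d\lambda = 2\pi\sqrt{\lambda'\mu\mu'}\,J_m(k\lambda')\,I_m(k\mu_<)\,K_m(k\mu_>), \] where, for $\lambda>0$, \[ \chi=\frac{4\lambda^2\mu^2+4\lambda'^2\mu'^2+(\lambda^2-\lambda'^2+\mu'^2-\mu^2)^2}{8\lambda\lambda'\mu\mu'}>1, \] and $\mu_<=\min\{\mu,\mu'\}$, $\mu_>=\max\{\mu,\mu'\}$.
   Context: $J_m$ is the Bessel function of the first kind, $I_m$ and $K_m$ are the modified Bessel functions of the first and second kind. $Q_\nu(z)=Q^0_\nu(z)$ is the Legendre function of the second kind, where for $z\in\mathbb{C}\setminus(-\infty,1]$, $Q^\mu_\nu(z)=e^{\mu\pi i}\frac{\sqrt{\pi}\,\Gamma(\nu+\mu+1)(z^2-1)^{\mu/2}}{2^{\nu+1}z^{\nu+\mu+1}}\,\mathbf{F}\!\left(\frac{\nu+\mu}{2}+1,\frac{\nu+\mu+1}{2};\nu+\frac32;\frac{1}{z^2}\right)$ with $\mathbf{F}={}_2F_1/\Gamma(c)$ the regularized hypergeometric function (principal branches). *)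

theory Defs
  imports "HOL-Analysis.Analysis"
begin

definition besselJ :: "nat \<Rightarrow> real \<Rightarrow> real" where
  "besselJ m x = (\<Sum>k. (-1)^k / (fact k * fact (k + m)) * (x / 2) ^ (2 * k + m))"

definition besselI :: "nat \<Rightarrow> real \<Rightarrow> real" where
  "besselI m x = (\<Sum>k. 1 / (fact k * fact (k + m)) * (x / 2) ^ (2 * k + m))"

text \<open>Modified Bessel function of the second kind of integer order m, for x > 0
  (standard integral representation, DLMF 10.32.9).\<close>
definition besselK :: "nat \<Rightarrow> real \<Rightarrow> real" where
  "besselK m x = integral {0..} (\<lambda>t. exp (- x * cosh t) * cosh (real m * t))"

text \<open>Regularized Gauss hypergeometric function F = 2F1/Gamma(c), for |w| < 1.\<close>
definition hyp2F1reg :: "real \<Rightarrow> real \<Rightarrow> real \<Rightarrow> real \<Rightarrow> real" where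
  "hyp2F1reg a b c w = (\<Sum>n. pochhammer a n * pochhammer b n / (Gamma (c + real n) * fact n) * w ^ n)"

text \<open>Legendre function of the second kind Q_nu(z) (mu = 0) for real z > 1,
  as given in the paper's context.\<close>
definition legendreQ :: "real \<Rightarrow> real \<Rightarrow> real" where
  "legendreQ \<nu> z = sqrt pi * Gamma (\<nu> + 1) / (2 powr (\<nu> + 1) * z powr (\<nu> + 1))
      * hyp2F1reg (\<nu> / 2 + 1) ((\<nu> + 1) / 2) (\<nu> + 3 / 2) (1 / z^2)"

definition chi :: "real \<Rightarrow> real \<Rightarrow> real \<Rightarrow> real \<Rightarrow> real" where
  "chi lam lam1 \<mu> mu1 = (4 * lam^2 * \<mu>^2 + 4 * lam1^2 * mu1^2 + (lam^2 - lam1^2 + mu1^2 - \<mu>^2)^2)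
                     / (8 * lam * lam1 * \<mu> * mu1)"

end

theory Submission
  imports Defs "HOL-Probability.Distributions"
begin

text \<open>
  Write \<open>S = \<lambda>\<^sup>2 + \<lambda>'\<^sup>2 + \<mu>\<^sup>2 + \<mu>'\<^sup>2\<close>. Expanding both Bessel functions, Vandermonde's identity turns the
  Laplace transform of \<open>I\<^sub>m(a u) I\<^sub>m(b u)\<close> at \<open>p\<close> into
  \<open>Q\<^bsub>m-1/2\<^esub>((p\<^sup>2 - a\<^sup>2 - b\<^sup>2) / (2 a b)) / (\<pi> \<surd>(a b))\<close>. With \<open>a = 2 \<mu> \<mu>'\<close>, \<open>b = 2 \<lambda> \<lambda>'\<close>, \<open>p = S\<close> the argument is
  exactly \<open>\<chi>\<close>, so \<open>Q\<^bsub>m-1/2\<^esub>(\<chi>)\<close> is a superposition over \<open>u > 0\<close> of products of two radial Gaussian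
  kernels, one in \<open>(\<lambda>, \<lambda>')\<close> and one in \<open>(\<mu>, \<mu>')\<close>. Since \<open>J\<^sub>m(x) = O(x\<^bsup>-1/2\<^esup>)\<close>, the double integral
  over \<open>u\<close> and \<open>\<lambda>\<close> converges absolutely. The \<open>\<lambda>\<close>-integral is Weber's second exponential integral,
  by the same use of Vandermonde's identity, and yields \<open>J\<^sub>m(k \<lambda>')\<close> times \<open>exp(-k\<^sup>2 / 4u)\<close>. As a
  function of \<open>min \<mu> \<mu>'\<close> the remaining \<open>u\<close>-integral is a solution of the modified Bessel equation that
  is regular at 0, hence a multiple of \<open>I\<^sub>m\<close>; its leading coefficient at 0 is the \<open>K\<^sub>m\<close> factor.
\<close>

section \<open>The Bessel-Clifford function\<close>

text \<open>An entire function carrying both Bessel families: up to the factor (x/2)^m it is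
  \<open>besselI\<close> at x^2/4 and \<open>besselJ\<close> at -x^2/4. In this normalisation
  differentiation just raises \<open>m\<close> by one.\<close>

definition bclifford :: "nat \<Rightarrow> real \<Rightarrow> real" where
  "bclifford m z = (\<Sum>j. z ^ j / (fact j * fact (j + m)))"

lemma summable_norm_bclifford: "summable (\<lambda>j. norm (z ^ j / (fact j * fact (j + m)) :: real))"
proof (rule summable_comparison_test')
  show "summable (\<lambda>j. \<bar>z\<bar> ^ j / fact j)"
    using summable_exp[of "\<bar>z\<bar>"] by (simp add: field_simps)
  fix j :: nat
  have "(1::real) \<le> fact (j + m)" by simp
  then have "fact j * 1 \<le> fact j * (fact (j + m) :: real)" by (intro mult_left_mono) auto
  then show "norm (norm (z ^ j / (fact j * fact (j + m)))) \<le> \<bar>z\<bar> ^ j / fact j"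
    by (auto simp: power_abs abs_mult intro!: divide_left_mono)
qed

lemma bclifford_sums: "(\<lambda>j. z ^ j / (fact j * fact (j + m))) sums bclifford m z"
  unfolding bclifford_def using summable_norm_bclifford[THEN summable_norm_cancel] by (rule summable_sums)

lemma besselI_eq_bclifford: "besselI m x = (x / 2) ^ m * bclifford m (x\<^sup>2 / 4)"
proof -
  have "(\<lambda>k. (x / 2) ^ m * ((x\<^sup>2 / 4) ^ k / (fact k * fact (k + m)))) sums ((x / 2) ^ m * bclifford m (x\<^sup>2 / 4))"
    by (intro sums_mult bclifford_sums)
  moreover have "(x / 2) ^ m * ((x\<^sup>2 / 4) ^ k / (fact k * fact (k + m)))
      = 1 / (fact k * fact (k + m)) * (x / 2) ^ (2 * k + m)" for k
    by (simp only: power_add power_mult) (simp add: power_divide mult_ac)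
  ultimately show ?thesis unfolding besselI_def by (simp add: sums_iff)
qed

lemma besselJ_eq_bclifford: "besselJ m x = (x / 2) ^ m * bclifford m (- (x\<^sup>2 / 4))"
proof -
  have "(\<lambda>k. (x / 2) ^ m * ((- (x\<^sup>2 / 4)) ^ k / (fact k * fact (k + m)))) sums ((x / 2) ^ m * bclifford m (- (x\<^sup>2 / 4)))"
    by (intro sums_mult bclifford_sums)
  moreover have "(x / 2) ^ m * ((- (x\<^sup>2 / 4)) ^ k / (fact k * fact (k + m)))
      = (-1) ^ k / (fact k * fact (k + m)) * (x / 2) ^ (2 * k + m)" for k
    by (simp only: power_add power_mult) (simp add: power_divide power_minus[of "_ / 4"] mult_ac)
  ultimately show ?thesis unfolding besselJ_def by (simp add: sums_iff)
qed

lemma bclifford_0 [simp]: "bclifford m 0 = 1 / fact m"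
  unfolding bclifford_def
  using suminf_finite[of "{0}" "\<lambda>j. 0 ^ j / (fact j * fact (j + m)) :: real"] by auto

lemma bclifford_nonneg: "z \<ge> 0 \<Longrightarrow> bclifford m z \<ge> 0"
  unfolding bclifford_def
  by (intro suminf_nonneg summable_norm_cancel[OF summable_norm_bclifford]) auto

lemma bclifford_pos: "z \<ge> 0 \<Longrightarrow> bclifford m z > 0"
  unfolding bclifford_def
  by (intro suminf_pos2[of _ 0] summable_norm_cancel[OF summable_norm_bclifford]) auto

lemma has_field_derivative_bclifford:
  "(bclifford m has_field_derivative bclifford (Suc m) z) (at z)"
proof -
  let ?c = "\<lambda>j. 1 / (fact j * fact (j + m)) :: real"
  have "DERIV (\<lambda>x. \<Sum>n. ?c n * x ^ n) z :> (\<Sum>n. diffs ?c n * z ^ n)"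
    using summable_norm_bclifford[THEN summable_norm_cancel]
    by (intro termdiffs_strong_converges_everywhere) simp
  moreover have "diffs ?c n = 1 / (fact n * fact (n + Suc m))" for n
    by (simp add: diffs_def divide_simps)
  ultimately show ?thesis by (simp add: bclifford_def[abs_def])
qed

lemmas DERIV_bclifford [derivative_intros] =
  has_field_derivative_bclifford[THEN DERIV_chain2]

lemma continuous_on_bclifford [continuous_intros]:
  "continuous_on S f \<Longrightarrow> continuous_on S (\<lambda>x. bclifford m (f x))"
  by (rule continuous_on_compose2[of UNIV "bclifford m"])
     (auto intro!: continuous_at_imp_continuous_on DERIV_isCont has_field_derivative_bclifford)

lemma borel_measurable_bclifford [measurable]: "bclifford m \<in> borel_measurable borel"
  by (intro borel_measurable_continuous_onI continuous_on_bclifford continuous_on_id)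

text \<open>In the series of order m+1 the factor j + (m+1) cancels the last factor of (j+m+1)!. As
  differentiation raises the order, this is the differential equation z y'' + (m+1) y' = y for
  \<open>bclifford m\<close>.\<close>

lemma bclifford_recurrence:
  "z * bclifford (Suc (Suc m)) z + (real m + 1) * bclifford (Suc m) z = bclifford m z"
proof -
  let ?f = "\<lambda>j. real j * z ^ j / (fact j * fact (j + Suc m))"
  have "?f (Suc j) = z * (z ^ j / (fact j * fact (j + Suc (Suc m))))" for j
    by (simp add: divide_simps)
  then have "(\<lambda>j. ?f (Suc j)) sums (z * bclifford (Suc (Suc m)) z)"
    using sums_mult[OF bclifford_sums[of z "Suc (Suc m)"], of z] by simp
  \<comment> \<open>The term of \<open>?f\<close> at 0 vanishes through its factor
    \<open>real j\<close>, so undoing the shift adds nothing.\<close>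
  then have "?f sums (z * bclifford (Suc (Suc m)) z)" by (subst (asm) sums_Suc_iff) simp
  from sums_add[OF this sums_mult[OF bclifford_sums[of z "Suc m"], of "real m + 1"]]
  have "(\<lambda>j. ?f j + (real m + 1) * (z ^ j / (fact j * fact (j + Suc m))))
          sums (z * bclifford (Suc (Suc m)) z + (real m + 1) * bclifford (Suc m) z)" .
  moreover have "?f j + (real m + 1) * (z ^ j / (fact j * fact (j + Suc m)))
      = z ^ j / (fact j * fact (j + m))" for j
    by (simp add: divide_simps) (simp add: algebra_simps)
  ultimately show ?thesis using bclifford_sums[of z m] sums_unique2 by simp
qed

text \<open>The coefficient 1/(j! (j+m)!) is binom(2j+m, j)/(2j+m)!, and the binomial is at most
  2^(2j+m), so the terms of index 2j+m in the series of exp(2x) dominate. The rate matters: it gives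
  I_m(x) <= exp x, hence Laplace transforms for every p > a + b.\<close>

lemma power_mult_bclifford_le_exp:
  assumes "x \<ge> 0"
  shows "x ^ m * bclifford m (x\<^sup>2) \<le> exp (2 * x)"
proof -
  have exp_sums: "(\<lambda>n. (2 * x) ^ n / fact n) sums exp (2 * x)"
    using exp_converges[of "2 * x"] by (simp add: field_simps)
  have term_le: "x ^ m * ((x\<^sup>2) ^ j / (fact j * fact (j + m))) \<le> (2 * x) ^ (2 * j + m) / fact (2 * j + m)" for j
  proof -
    have "real ((2 * j + m) choose j) \<le> 2 ^ (2 * j + m)"
      using binomial_le_pow2[of "2 * j + m" j] by (metis of_nat_le_iff of_nat_numeral of_nat_power)
    moreover have "real ((2 * j + m) choose j) = fact (2 * j + m) / (fact j * fact (j + m))"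
      by (subst binomial_fact) (auto simp: mult_2 add.assoc)
    ultimately have "fact (2 * j + m) / (fact j * fact (j + m)) \<le> (2 ^ (2 * j + m) :: real)"
      by simp
    then have "1 / (fact j * fact (j + m)) \<le> (2 ^ (2 * j + m) / fact (2 * j + m) :: real)"
      by (simp add: divide_simps mult_ac)
    then have "x ^ (2 * j + m) * (1 / (fact j * fact (j + m))) \<le> x ^ (2 * j + m) * (2 ^ (2 * j + m) / fact (2 * j + m))"
      using assms by (intro mult_left_mono) auto
    moreover have "x ^ (2 * j + m) * (1 / (fact j * fact (j + m))) = x ^ m * ((x\<^sup>2) ^ j / (fact j * fact (j + m)))"
      by (simp add: power_add power_mult)
    moreover have "x ^ (2 * j + m) * (2 ^ (2 * j + m) / fact (2 * j + m)) = (2 * x) ^ (2 * j + m) / fact (2 * j + m)"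
      by (simp only: power_mult_distrib) simp
    ultimately show ?thesis by (simp only:)
  qed
  let ?h = "\<lambda>n. (2 * x) ^ n / fact n"
  have s: "(\<lambda>j. x ^ m * ((x\<^sup>2) ^ j / (fact j * fact (j + m)))) sums (x ^ m * bclifford m (x\<^sup>2))"
    by (intro sums_mult bclifford_sums)
  show ?thesis
  proof (rule LIMSEQ_le_const2)
    show "(\<lambda>N. \<Sum>j<N. x ^ m * ((x\<^sup>2) ^ j / (fact j * fact (j + m)))) \<longlonglongrightarrow> x ^ m * bclifford m (x\<^sup>2)"
      using s by (simp add: sums_def)
    show "\<exists>N0. \<forall>N\<ge>N0. (\<Sum>j<N. x ^ m * ((x\<^sup>2) ^ j / (fact j * fact (j + m)))) \<le> exp (2 * x)"
    proof (intro exI allI impI)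
      fix N :: nat
      have "(\<Sum>j<N. x ^ m * ((x\<^sup>2) ^ j / (fact j * fact (j + m)))) \<le> (\<Sum>j<N. ?h (2 * j + m))"
        by (intro sum_mono term_le)
      \<comment> \<open>The indices 2j+m are distinct, so this is part of an exponential series with
        nonnegative terms.\<close>
      also have "\<dots> = sum ?h ((\<lambda>j. 2 * j + m) ` {..<N})"
        by (subst sum.reindex) (auto simp: inj_on_def)
      also have "\<dots> \<le> suminf ?h"
        using exp_sums assms by (intro sum_le_suminf) (auto simp: sums_iff)
      finally show "(\<Sum>j<N. x ^ m * ((x\<^sup>2) ^ j / (fact j * fact (j + m)))) \<le> exp (2 * x)"
        using exp_sums by (simp add: sums_iff)
    qed
  qed
qed

text \<open>The terms decrease in \<open>m\<close>, so the previous bound at order 0, where the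
  prefactor x^m is absent, covers all orders.\<close>

lemma bclifford_le_exp:
  assumes "x \<ge> 0"
  shows "bclifford m (x\<^sup>2) \<le> exp (2 * x)"
proof -
  have "bclifford m (x\<^sup>2) \<le> bclifford 0 (x\<^sup>2)"
    unfolding bclifford_def
  proof (intro suminf_le summable_norm_bclifford[THEN summable_norm_cancel])
    fix j :: nat
    have "(fact j :: real) * fact j \<le> fact j * fact (j + m)" by (intro mult_left_mono fact_mono) auto
    then show "(x\<^sup>2) ^ j / (fact j * fact (j + m)) \<le> (x\<^sup>2) ^ j / (fact j * fact (j + 0))"
      using assms by (intro divide_left_mono) auto
  qed
  also have "\<dots> \<le> exp (2 * x)" using power_mult_bclifford_le_exp[OF assms, of 0] by simp
  finally show ?thesis .
qed

section \<open>Sign, growth and measurability of the Bessel functions\<close>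

lemma besselI_nonneg: "x \<ge> 0 \<Longrightarrow> besselI m x \<ge> 0"
  by (simp add: besselI_eq_bclifford bclifford_nonneg)

lemma besselI_le_exp: "x \<ge> 0 \<Longrightarrow> besselI m x \<le> exp x"
  using power_mult_bclifford_le_exp[of "x / 2" m] by (simp add: besselI_eq_bclifford power_divide)

lemma borel_measurable_besselI [measurable]: "besselI m \<in> borel_measurable borel"
  unfolding besselI_eq_bclifford[abs_def] by measurable

lemma borel_measurable_besselJ [measurable]: "besselJ m \<in> borel_measurable borel"
  unfolding besselJ_eq_bclifford[abs_def] by measurable

section \<open>Interchange and resummation of double series\<close>

text \<open>The pairs are enumerated by \<open>prod_decode\<close>, and integrability of
  \<open>h\<close> bounds all partial sums of the integrated absolute values. Absolute summability
  then restores an unordered sum, as the later rearrangements require.\<close>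

lemma has_sum_integral:
  fixes f :: "nat \<times> nat \<Rightarrow> 'a \<Rightarrow> real"
  assumes meas: "\<And>i. f i \<in> borel_measurable M"
    and h: "integrable M h"
    and norm_sum: "\<And>x. x \<in> space M \<Longrightarrow> ((\<lambda>i. \<bar>f i x\<bar>) has_sum h x) UNIV"
    and f_sum: "\<And>x. x \<in> space M \<Longrightarrow> ((\<lambda>i. f i x) has_sum s x) UNIV"
  shows "((\<lambda>i. \<integral>x. f i x \<partial>M) has_sum (\<integral>x. s x \<partial>M)) UNIV"
proof -
  define F where "F = (\<lambda>n. f (prod_decode n))"
  have norm_sums: "(\<lambda>n. \<bar>F n x\<bar>) sums h x" if "x \<in> space M" for x
    using norm_sum[OF that] has_sum_reindex_bij_betw[OF bij_prod_decode, of "\<lambda>i. \<bar>f i x\<bar>" "h x"]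
    unfolding F_def by (intro has_sum_imp_sums) simp
  have F_sums: "(\<lambda>n. F n x) sums s x" if "x \<in> space M" for x
    using f_sum[OF that] has_sum_reindex_bij_betw[OF bij_prod_decode, of "\<lambda>i. f i x" "s x"]
    unfolding F_def by (intro has_sum_imp_sums) simp
  have sum_le: "(\<Sum>n\<in>A. \<bar>F n x\<bar>) \<le> h x" if "x \<in> space M" "finite A" for x A
    using sum_le_suminf[of "\<lambda>n. \<bar>F n x\<bar>" A] norm_sums[OF that(1)] that(2) by (auto simp: sums_iff)
  have int_F: "integrable M (F n)" for n
  proof (rule Bochner_Integration.integrable_bound[OF h])
    show "F n \<in> borel_measurable M" unfolding F_def by (rule meas)
    show "AE x in M. norm (F n x) \<le> norm (h x)"
      using sum_le[of _ "{n}"] by (intro AE_I2) force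
  qed
  have summ: "summable (\<lambda>n. \<integral>x. norm (F n x) \<partial>M)"
  proof (rule summableI_nonneg_bounded)
    show "(\<Sum>i<n. \<integral>x. norm (F i x) \<partial>M) \<le> (\<integral>x. h x \<partial>M)" for n
    proof -
      have "(\<Sum>i<n. \<integral>x. norm (F i x) \<partial>M) = (\<integral>x. (\<Sum>i<n. norm (F i x)) \<partial>M)"
        using int_F by (intro Bochner_Integration.integral_sum[symmetric]) auto
      also have "\<dots> \<le> (\<integral>x. h x \<partial>M)"
        using sum_le int_F h by (intro integral_mono) auto
      finally show ?thesis .
    qed
  qed auto
  have "(\<lambda>n. \<integral>x. F n x \<partial>M) sums (\<integral>x. (\<Sum>n. F n x) \<partial>M)"
    using int_F summ norm_sums by (intro sums_integral) (auto simp: sums_iff)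
  also have "(\<integral>x. (\<Sum>n. F n x) \<partial>M) = (\<integral>x. s x \<partial>M)"
    using F_sums by (intro Bochner_Integration.integral_cong) (auto simp: sums_iff)
  finally have "(\<lambda>n. \<integral>x. F n x \<partial>M) sums (\<integral>x. s x \<partial>M)" .
  moreover have "summable (\<lambda>n. norm (\<integral>x. F n x \<partial>M))"
    by (rule summable_comparison_test'[OF summ]) simp
  ultimately have "((\<lambda>n. \<integral>x. F n x \<partial>M) has_sum (\<integral>x. s x \<partial>M)) UNIV"
    by (rule norm_summable_imp_has_sum[rotated])
  then show ?thesis
    unfolding F_def by (subst (asm) has_sum_reindex_bij_betw[OF bij_prod_decode])
qed

text \<open>On the reals unordered summability is absolute summability, so the product family is
  summable without further hypotheses.\<close>

lemma has_sum_product_real: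
  fixes f g :: "_ \<Rightarrow> real"
  assumes f: "(f has_sum a) A" and g: "(g has_sum b) B"
  shows "((\<lambda>(i, j). f i * g j) has_sum (a * b)) (A \<times> B)"
proof (rule has_sum_SigmaI)
  show "((\<lambda>j. case (i, j) of (i, j) \<Rightarrow> f i * g j) has_sum f i * b) B" for i
    using has_sum_cmult_right[OF g, of "f i"] by simp
  show "((\<lambda>i. f i * b) has_sum a * b) A" by (rule has_sum_cmult_left[OF f])
  have f': "(\<lambda>i. norm (f i)) summable_on A" and g': "(\<lambda>j. norm (g j)) summable_on B"
    using f g by (simp_all only: has_sum_imp_summable flip: summable_on_iff_abs_summable_on_real)
  have "(\<lambda>p. norm (case p of (i, j) \<Rightarrow> f i * g j)) summable_on A \<times> B"
    unfolding Infinite_Sum.abs_summable_on_Sigma_iff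
    using f' g' by (auto simp: abs_mult infsum_cmult_right' abs_of_nonneg infsum_nonneg
        intro!: summable_on_cmult_right summable_on_cmult_left)
  then show "(\<lambda>(i, j). f i * g j) summable_on A \<times> B" by (rule Infinite_Sum.abs_summable_summable)
qed

text \<open>Vandermonde's identity for binom(j+l+m, l), with the upper entry split as j + (l+m),
  divided by j! (l+m)!. For fixed n the summand on the right is a product of a function of
  \<open>j\<close> and a function of \<open>l\<close>.\<close>

lemma fact_quotient_eq_sum:
  "fact (j + l + m) / (fact j * fact (j + m) * fact l * fact (l + m)) =
     (\<Sum>n\<le>min j l. 1 / (fact n * fact (n + m) * fact (j - n) * fact (l - n)) :: real)"
proof -
  have "fact (j + l + m) / (fact l * fact (j + m)) = real ((j + (l + m)) choose l)"
    by (subst binomial_fact) (auto simp: add_ac)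
  also have "\<dots> = (\<Sum>n\<le>l. real (j choose n) * real ((l + m) choose (l - n)))"
    using vandermonde[of j "l + m" l] by (simp flip: of_nat_mult of_nat_sum)
  also have "\<dots> = (\<Sum>n\<le>min j l. real (j choose n) * real ((l + m) choose (l - n)))"
    by (intro sum.mono_neutral_right) (auto simp: binomial_eq_0)
  also have "\<dots> = (\<Sum>n\<le>min j l. (fact j * fact (l + m)) *
      (1 / (fact n * fact (n + m) * fact (j - n) * fact (l - n))))"
    by (intro sum.cong) (auto simp: binomial_fact add_ac)
  also have "\<dots> = (fact j * fact (l + m)) * (\<Sum>n\<le>min j l. 1 / (fact n * fact (n + m) * fact (j - n) * fact (l - n)))"
    by (rule sum_distrib_left[symmetric])
  finally show ?thesis by (simp add: divide_simps mult_ac)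
qed

text \<open>The common engine of both integral evaluations below. Spreading each coefficient over n
  gives a triple family; with j = n+i and l = n+i' it is summed over i', then i, then n.\<close>

lemma vandermonde_resummation:
  fixes w :: "nat \<Rightarrow> nat \<Rightarrow> real"
  assumes "((\<lambda>(j, l). fact (j + l + m) / (fact j * fact (j + m) * fact l * fact (l + m)) * w j l) has_sum S) UNIV"
    and inner: "\<And>n i. ((\<lambda>i'. w (n + i) (n + i') / (fact i * fact i')) has_sum v n i) UNIV"
    and outer: "\<And>n. (v n has_sum u n) UNIV"
  shows "((\<lambda>n. u n / (fact n * fact (n + m))) has_sum S) UNIV"
proof -
  let ?c = "\<lambda>j l. fact (j + l + m) / (fact j * fact (j + m) * fact l * fact (l + m)) :: real"
  let ?g = "\<lambda>((j, l), n). w j l / (fact n * fact (n + m) * fact (j - n) * fact (l - n))"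
  let ?B = "\<lambda>(j, l). {..min j l :: nat}"
  have inner_sum: "((\<lambda>n. ?g (p, n)) has_sum (case p of (j, l) \<Rightarrow> ?c j l * w j l)) (?B p)" for p
    by (cases p) (auto intro!: has_sum_finiteI simp: fact_quotient_eq_sum sum_distrib_right)
  have "(\<lambda>x. norm (?g x)) summable_on Sigma UNIV ?B"
    unfolding Infinite_Sum.abs_summable_on_Sigma_iff
  proof (intro conjI ballI)
    show "(\<lambda>n. norm (?g (p, n))) summable_on ?B p" for p
      by (cases p) auto
    \<comment> \<open>The Vandermonde coefficients are positive, so taking absolute values inside
      the sum over n loses nothing, whatever the sign of \<open>w\<close>: absolute summability
      passes from the double to the triple family.\<close>
    have "infsum (\<lambda>n. norm (?g (p, n))) (?B p) = norm (case p of (j, l) \<Rightarrow> ?c j l * w j l)" for p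
    proof (cases p)
      case (Pair j l)
      have "norm (?c j l * w j l) = ?c j l * \<bar>w j l\<bar>" by (simp add: abs_mult)
      then show ?thesis unfolding Pair fact_quotient_eq_sum sum_distrib_right by (simp add: abs_mult)
    qed
    moreover have "(\<lambda>p. norm (case p of (j, l) \<Rightarrow> ?c j l * w j l)) summable_on UNIV"
      using iffD1[OF summable_on_iff_abs_summable_on_real has_sum_imp_summable[OF assms(1)]] .
    ultimately show "(\<lambda>p. norm (infsum (\<lambda>n. norm (?g (p, n))) (?B p))) summable_on UNIV"
      by (simp only: real_norm_def abs_idempotent)
  qed
  then have "?g summable_on Sigma UNIV ?B" by (rule Infinite_Sum.abs_summable_summable)
  from has_sum_SigmaI[OF inner_sum assms(1) this]
  have "(?g has_sum S) (Sigma UNIV ?B)" .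
  moreover let ?h = "\<lambda>(n, i, i'). w (n + i) (n + i') / (fact n * fact (n + m) * fact i * fact i')"
  have "(?g has_sum S) (Sigma UNIV ?B) \<longleftrightarrow> (?h has_sum S) (UNIV \<times> UNIV \<times> UNIV)"
    by (rule has_sum_reindex_bij_witness[of _ "\<lambda>(n, i, i'). ((n + i, n + i'), n)" "\<lambda>((j, l), n). (n, j - n, l - n)"])
       auto
  ultimately have h: "(?h has_sum S) (UNIV \<times> UNIV \<times> UNIV)" by simp
  have mid: "((\<lambda>p. ?h (n, p)) has_sum (u n / (fact n * fact (n + m)))) (UNIV \<times> UNIV)" for n
  proof (rule has_sum_SigmaI)
    have "((\<lambda>i'. 1 / (fact n * fact (n + m)) * (w (n + i) (n + i') / (fact i * fact i'))) has_sum 1 / (fact n * fact (n + m)) * v n i) UNIV" for i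
      by (rule has_sum_cmult_right[OF inner])
    then show "((\<lambda>i'. ?h (n, i, i')) has_sum 1 / (fact n * fact (n + m)) * v n i) UNIV" for i
      by (simp add: mult.assoc)
    show "((\<lambda>i. 1 / (fact n * fact (n + m)) * v n i) has_sum u n / (fact n * fact (n + m))) UNIV"
      using has_sum_cmult_right[OF outer, of "1 / (fact n * fact (n + m))" n] by simp
    have "(\<lambda>(x, y). ?h (x, y)) summable_on UNIV \<times> (UNIV \<times> UNIV)"
      using h by (auto simp: has_sum_iff case_prod_unfold)
    from summable_on_SigmaD1[OF this, of n]
    show "(\<lambda>p. ?h (n, p)) summable_on UNIV \<times> UNIV" by simp
  qed
  show ?thesis by (rule has_sum_SigmaD[OF h mid])
qed

section \<open>The Laplace transform of a product of modified Bessel functions\<close>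

text \<open>The origin is left out because integrands below contain 1/u and exp(-\<kappa>/u); the
  difference from \<open>{0..}\<close> is a null set.\<close>

abbreviation halfline :: "real measure" where
  "halfline \<equiv> restrict_space lborel {0<..}"

lemma sigma_finite_halfline: "sigma_finite_measure halfline"
  by (intro sigma_finite_measure_restrict_space lborel.sigma_finite_measure_axioms) auto

lemma has_bochner_integral_halfline_iff:
  fixes f :: "real \<Rightarrow> real"
  assumes [measurable]: "f \<in> borel_measurable borel"
  shows "has_bochner_integral halfline f I \<longleftrightarrow> has_bochner_integral lborel (\<lambda>x. indicator {0..} x *\<^sub>R f x) I"
proof -
  have "has_bochner_integral halfline f I \<longleftrightarrow> has_bochner_integral lborel (\<lambda>x. indicator {0<..} x *\<^sub>R f x) I"
    by (subst has_bochner_integral_restrict_space) auto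
  also have "\<dots> \<longleftrightarrow> has_bochner_integral lborel (\<lambda>x. indicator {0..} x *\<^sub>R f x) I"
  proof (rule has_bochner_integral_cong_AE)
    show "AE x in lborel. indicator {0<..} x *\<^sub>R f x = indicator {0..} x *\<^sub>R f x"
      using AE_lborel_singleton[of 0] by eventually_elim (auto simp: indicator_def)
  qed measurable
  finally show ?thesis .
qed

lemma borel_measurable_halfline [measurable (raw)]:
  "f \<in> borel_measurable borel \<Longrightarrow> f \<in> borel_measurable halfline"
  by (rule measurable_restrict_space1) simp

section \<open>Moments of exponential and Gaussian weights\<close>

lemma has_bochner_integral_power_exp:
  assumes p: "p > 0"
  shows "has_bochner_integral halfline (\<lambda>u. u ^ n * exp (- (p * u))) (fact n / p ^ Suc n)"
proof -
  have "has_bochner_integral lborel (\<lambda>x. (x ^ n * exp (- x)) * indicator {0..} x) (fact n :: real)"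
  proof (rule has_bochner_integral_nn_integral)
    show "(\<integral>\<^sup>+ x. ennreal (x ^ n * exp (- x) * indicator {0..} x) \<partial>lborel) = ennreal (fact n)"
      using nn_intergal_power_times_exp_Ici[of n]
      by (simp add: ennreal_mult'' ennreal_indicator)
  qed (auto simp: indicator_def)
  then have "has_bochner_integral lborel (\<lambda>x. ((p * x) ^ n * exp (- (p * x))) * indicator {0..} (p * x)) (fact n / p)"
    using p lborel_has_bochner_integral_real_affine_iff[of p "\<lambda>x. (x ^ n * exp (- x)) * indicator {0..} x" "fact n" 0]
    by (simp add: divide_inverse mult_ac)
  from has_bochner_integral_mult_right[OF this, of "1 / p ^ n"]
  have "has_bochner_integral lborel (\<lambda>x. indicator {0..} x *\<^sub>R (x ^ n * exp (- (p * x)))) (fact n / p ^ Suc n)"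
    by (rule back_subst[where P = "\<lambda>f. has_bochner_integral lborel f _", OF back_subst[where P = "has_bochner_integral lborel _"]])
       (use p in \<open>auto simp: indicator_def power_mult_distrib zero_le_mult_iff fun_eq_iff\<close>)
  then show ?thesis by (subst has_bochner_integral_halfline_iff) auto
qed

lemma has_bochner_integral_odd_power_gaussian:
  assumes s: "s > 0"
  shows "has_bochner_integral halfline (\<lambda>x. x ^ (2 * n + 1) * exp (- (s * x\<^sup>2))) (fact n / (2 * s ^ Suc n))"
proof -
  define c where "c = sqrt s"
  have c: "c > 0" "s = c\<^sup>2" using s by (auto simp: c_def)
  let ?f = "\<lambda>x. indicator {0..} x *\<^sub>R (exp (- x\<^sup>2) * x ^ (2 * n + 1)) :: real"
  have "has_bochner_integral lborel (\<lambda>x. ?f (0 + c * x)) ((fact n / 2) /\<^sub>R \<bar>c\<bar>)"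
    using c(1) gaussian_moment_odd_pos[of n] by (subst lborel_has_bochner_integral_real_affine_iff[symmetric]) auto
  from has_bochner_integral_mult_right[OF this, of "1 / c ^ (2 * n + 1)"]
  have "has_bochner_integral lborel (\<lambda>x. 1 / c ^ (2 * n + 1) * ?f (0 + c * x)) (1 / c ^ (2 * n + 1) * ((fact n / 2) /\<^sub>R \<bar>c\<bar>))"
    by blast
  also have "(\<lambda>x. 1 / c ^ (2 * n + 1) * ?f (0 + c * x)) = (\<lambda>x. indicator {0..} x *\<^sub>R (x ^ (2 * n + 1) * exp (- (s * x\<^sup>2))))"
  proof
    fix x
    have "(c * x) ^ (2 * n + 1) = c ^ (2 * n + 1) * x ^ (2 * n + 1)" by (rule power_mult_distrib)
    moreover have "(indicator {0..} (c * x) :: real) = indicator {0..} x"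
      using c(1) by (simp add: indicator_def zero_le_mult_iff)
    moreover have "c ^ (2 * n + 1) \<noteq> 0" using c(1) by simp
    ultimately show "1 / c ^ (2 * n + 1) * ?f (0 + c * x) = indicator {0..} x *\<^sub>R (x ^ (2 * n + 1) * exp (- (s * x\<^sup>2)))"
      using c(1) unfolding c(2) by (simp only: add_0_left power_mult_distrib[of c x 2] real_scaleR_def) simp
  qed
  also have "1 / c ^ (2 * n + 1) * ((fact n / 2) /\<^sub>R \<bar>c\<bar>) = fact n / (2 * s ^ Suc n)"
  proof -
    have "s ^ Suc n = c ^ (2 * n + 1) * c"
      unfolding c(2) power_mult[symmetric] by simp
    then show ?thesis using c(1) by (simp add: divide_simps)
  qed
  finally show ?thesis by (subst has_bochner_integral_halfline_iff) auto
qed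

lemma integrable_halfline_exp: "p > 0 \<Longrightarrow> integrable halfline (\<lambda>u. exp (- (p * u)))"
  using has_bochner_integral_power_exp[of p 0] by (auto simp: has_bochner_integral_iff)

section \<open>Bessel and negative binomial series as unordered sums\<close>

lemma besselI_has_sum:
  "((\<lambda>j. (x / 2) ^ (2 * j + m) / (fact j * fact (j + m))) has_sum besselI m x) UNIV"
proof -
  have "((\<lambda>j. (x\<^sup>2 / 4) ^ j / (fact j * fact (j + m))) has_sum bclifford m (x\<^sup>2 / 4)) UNIV"
    by (rule norm_summable_imp_has_sum[OF summable_norm_bclifford bclifford_sums])
  from has_sum_cmult_right[OF this, of "(x / 2) ^ m"] show ?thesis
    unfolding besselI_eq_bclifford
    by (rule back_subst[where P = "\<lambda>f. (f has_sum _) UNIV"])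
       (simp only: power_add power_mult, simp add: power_divide mult_ac)
qed

lemma besselJ_has_sum:
  "((\<lambda>j. (-1) ^ j * (x / 2) ^ (2 * j + m) / (fact j * fact (j + m))) has_sum besselJ m x) UNIV"
proof -
  have "((\<lambda>j. (- (x\<^sup>2 / 4)) ^ j / (fact j * fact (j + m))) has_sum bclifford m (- (x\<^sup>2 / 4))) UNIV"
    by (rule norm_summable_imp_has_sum[OF summable_norm_bclifford bclifford_sums])
  from has_sum_cmult_right[OF this, of "(x / 2) ^ m"] show ?thesis
    unfolding besselJ_eq_bclifford
    by (rule back_subst[where P = "\<lambda>f. (f has_sum _) UNIV"])
       (simp only: power_add power_mult, simp add: power_divide power_minus[of "_ / 4"] mult_ac)
qed

lemma negative_binomial_has_sum:
  fixes s z :: real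
  assumes "0 \<le> z" "z < 1" "s > 0"
  shows "((\<lambda>r. pochhammer s r / fact r * z ^ r) has_sum (1 - z) powr (- s)) UNIV"
proof -
  have "(\<lambda>r. (- s gchoose r) * (- z) ^ r) sums (1 + - z) powr (- s)"
    by (rule gen_binomial_real) (use assms in auto)
  moreover have "(- s gchoose r) * (- z) ^ r = pochhammer s r / fact r * z ^ r" for r
  proof -
    have "(- s gchoose r) * (- z) ^ r = ((- 1) ^ r * (- 1) ^ r) * (pochhammer s r / fact r * z ^ r)"
      by (simp only: gbinomial_pochhammer power_minus[of z] minus_minus) (simp only: divide_inverse mult_ac)
    also have "(- 1) ^ r * (- 1) ^ r = (1 :: real)" by (simp flip: power_mult_distrib)
    finally show ?thesis by simp
  qed
  ultimately have "(\<lambda>r. pochhammer s r / fact r * z ^ r) sums (1 - z) powr (- s)" by simp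
  \<comment> \<open>All terms are nonnegative, so ordered convergence is already unordered.\<close>
  then show ?thesis
    using assms by (intro sums_nonneg_imp_has_sum_strong always_eventually) (auto intro!: mult_nonneg_nonneg divide_nonneg_nonneg pochhammer_nonneg)
qed

text \<open>Both Bessel series are integrated termwise. With N = j+l+m the moment contributes (2N)!
  = 4^N (1/2)_N N!; here N! is the numerator that \<open>vandermonde_resummation\<close> asks for,
  and both inner sums are negative binomial series.\<close>

lemma laplace_besselI_besselI_has_sum:
  assumes a: "a > 0" and b: "b > 0" and p: "p > a + b"
  shows "((\<lambda>n. pochhammer (1/2) (2 * n + m) * (a * b) ^ (2 * n + m) * (p\<^sup>2 - a\<^sup>2 - b\<^sup>2) powr (- (real (2 * n + m) + 1/2))
            / (fact n * fact (n + m))) has_sum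
          (\<integral>u. exp (- (p * u)) * besselI m (a * u) * besselI m (b * u) \<partial>halfline)) UNIV"
proof -
  define f where "f = (\<lambda>(j, l) u. exp (- (p * u)) *
     (((a * u) / 2) ^ (2 * j + m) / (fact j * fact (j + m)) * (((b * u) / 2) ^ (2 * l + m) / (fact l * fact (l + m)))))"
  \<comment> \<open>What is left of an integrated coefficient once the quotient of factorials is
    split off; the powers of 2 have cancelled.\<close>
  define w where "w = (\<lambda>j l. pochhammer (1/2) (j + l + m) * a ^ (2 * j + m) * b ^ (2 * l + m) / p ^ (2 * (j + l + m) + 1) :: real)"
  let ?I = "\<lambda>u. exp (- (p * u)) * besselI m (a * u) * besselI m (b * u)"
  have p0: "p > 0" using a b p by auto
  have ident: "p\<^sup>2 - a\<^sup>2 - b\<^sup>2 > 0"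
  proof -
    have "p\<^sup>2 > (a + b)\<^sup>2" using a b p by (intro power_strict_mono) auto
    moreover have "a * b > 0" using a b by simp
    ultimately show ?thesis by (simp add: power2_eq_square algebra_simps)
  qed
  have f_sum: "((\<lambda>i. f i u) has_sum ?I u) UNIV" for u
    using has_sum_cmult_right[OF has_sum_product_real[OF besselI_has_sum[of "a * u" m] besselI_has_sum[of "b * u" m]], of "exp (- (p * u))"]
    by (simp add: f_def case_prod_unfold mult.assoc)
  have f_nonneg: "\<bar>f i u\<bar> = f i u" if "u \<in> space halfline" for i u
    using that a b by (auto simp: f_def space_restrict_space split: prod.splits)
  have int_I: "integrable halfline ?I"
  proof (rule Bochner_Integration.integrable_bound)
    \<comment> \<open>The bound I_m(x) <= exp x leaves the decay rate p - a - b, positive by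
      hypothesis.\<close>
    show "integrable halfline (\<lambda>u. exp (- ((p - a - b) * u)))"
      using p by (intro integrable_halfline_exp) auto
    show "AE u in halfline. norm (?I u) \<le> norm (exp (- ((p - a - b) * u)))"
    proof (rule AE_I2)
      fix u assume "u \<in> space halfline"
      then have u: "u > 0" by (simp add: space_restrict_space)
      have "?I u \<le> exp (- (p * u)) * exp (a * u) * exp (b * u)"
        using u a b by (intro mult_mono besselI_le_exp besselI_nonneg mult_nonneg_nonneg) auto
      also have "\<dots> = exp (- ((p - a - b) * u))"
        by (simp add: algebra_simps flip: exp_add)
      finally show "norm (?I u) \<le> norm (exp (- ((p - a - b) * u)))"
        using u a b by (simp add: abs_of_nonneg besselI_nonneg)
    qed
  qed measurable
  have int_f: "(\<integral>u. f (j, l) u \<partial>halfline) =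
      fact (j + l + m) / (fact j * fact (j + m) * fact l * fact (l + m)) * w j l" for j l
  proof -
    let ?N = "j + l + m"
    have "f (j, l) u = (a / 2) ^ (2 * j + m) * (b / 2) ^ (2 * l + m) / (fact j * fact (j + m) * fact l * fact (l + m))
            * (u ^ (2 * ?N) * exp (- (p * u)))" for u
      by (simp add: f_def power_mult_distrib power_divide power_add mult_2) (simp add: mult_ac)
    then have "(\<integral>u. f (j, l) u \<partial>halfline) = (a / 2) ^ (2 * j + m) * (b / 2) ^ (2 * l + m) / (fact j * fact (j + m) * fact l * fact (l + m))
       * (fact (2 * ?N) / p ^ Suc (2 * ?N))"
      using has_bochner_integral_power_exp[OF p0, of "2 * ?N"] by (simp add: has_bochner_integral_iff)
    also have "fact (2 * ?N) = (2 ^ (2 * ?N) * pochhammer (1/2) ?N * fact ?N :: real)"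
      by (rule fact_double)
    also have "(a / 2) ^ (2 * j + m) * (b / 2) ^ (2 * l + m) = a ^ (2 * j + m) * b ^ (2 * l + m) / 2 ^ (2 * ?N)"
      by (simp add: power_divide power_add mult_2)
    finally show ?thesis by (simp add: w_def mult_ac)
  qed
  have "((\<lambda>i. \<integral>u. f i u \<partial>halfline) has_sum (\<integral>u. ?I u \<partial>halfline)) UNIV"
  proof (rule has_sum_integral[OF _ int_I])
    show "f i \<in> borel_measurable halfline" for i
      by (cases i) (simp add: f_def, measurable)
    show "((\<lambda>i. \<bar>f i u\<bar>) has_sum ?I u) UNIV" if "u \<in> space halfline" for u
      using f_sum[of u] by (simp add: f_nonneg[OF that])
  qed (use f_sum in auto)
  also have "(\<lambda>i. \<integral>u. f i u \<partial>halfline) = (\<lambda>(j, l). fact (j + l + m) / (fact j * fact (j + m) * fact l * fact (l + m)) * w j l)"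
    using int_f by auto
  finally have dbl: "((\<lambda>(j, l). fact (j + l + m) / (fact j * fact (j + m) * fact l * fact (l + m)) * w j l) has_sum
      (\<integral>u. ?I u \<partial>halfline)) UNIV" .
  define x y where "x = a\<^sup>2 / p\<^sup>2" and "y = b\<^sup>2 / p\<^sup>2"
  \<comment> \<open>The factors of (1/2)_(2n+m+i+i') beyond (1/2)_(2n+m) start at \<open>s n\<close>
    and split into (s n)_i and (s n + i)_i', the coefficients of two successive negative binomial
    series.\<close>
  define s where "s = (\<lambda>n. 1/2 + real (2 * n + m))"
  define A where "A = (\<lambda>n. pochhammer (1/2) (2 * n + m) * (a * b) ^ (2 * n + m) / p ^ (2 * (2 * n + m) + 1))"
  have xy: "x > 0" "y > 0" "x + y < 1" "1 - x - y = (p\<^sup>2 - a\<^sup>2 - b\<^sup>2) / p\<^sup>2"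
    using ident a b p0 by (auto simp: x_def y_def field_simps)
  have w_eq: "w (n + i) (n + i') / (fact i * fact i') =
       A n * (pochhammer (s n) i / fact i * x ^ i) * (pochhammer (s n + i) i' / fact i' * y ^ i')" for n i i'
  proof -
    have *: "n + i + (n + i') + m = (2 * n + m) + (i + i')" by simp
    have "pochhammer (1/2) (n + i + (n + i') + m) = pochhammer (1/2) (2 * n + m) * pochhammer (s n) i * pochhammer (s n + i) i'"
      unfolding * pochhammer_product' s_def by simp
    moreover have "p ^ (2 * (n + i + (n + i') + m) + 1) = p ^ (2 * (2 * n + m) + 1) * (p\<^sup>2) ^ i * (p\<^sup>2) ^ i'"
      unfolding power_mult[symmetric] power_add[symmetric] by (rule arg_cong[where f = "power p"]) simp
    moreover have "c ^ (2 * (n + i) + m) = c ^ (2 * n + m) * (c\<^sup>2) ^ i" for c :: real and i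
      unfolding power_mult[symmetric] power_add[symmetric] by (rule arg_cong[where f = "power c"]) simp
    ultimately show ?thesis
      unfolding w_def A_def x_def y_def power_divide power_mult_distrib by (simp only: mult_ac times_divide_times_eq times_divide_eq_left times_divide_eq_right divide_divide_eq_left)
  qed
  have "((\<lambda>n. A n * (1 - x - y) powr (- s n) / (fact n * fact (n + m))) has_sum (\<integral>u. ?I u \<partial>halfline)) UNIV"
  proof (rule vandermonde_resummation[OF dbl])
    fix n i
    have s: "s n > 0" by (simp add: s_def)
    have "((\<lambda>i'. A n * (pochhammer (s n) i / fact i * x ^ i) * (pochhammer (s n + i) i' / fact i' * y ^ i')) has_sum
        A n * (pochhammer (s n) i / fact i * x ^ i) * (1 - y) powr (- (s n + i))) UNIV"
      using xy s by (intro has_sum_cmult_right negative_binomial_has_sum) auto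
    then show "((\<lambda>i'. w (n + i) (n + i') / (fact i * fact i')) has_sum
        A n * (pochhammer (s n) i / fact i * x ^ i) * (1 - y) powr (- (s n + i))) UNIV"
      unfolding w_eq .
    \<comment> \<open>Summing over i' has left the factor (1-y)^(-i), which turns x into x/(1-y).
      The two powers then combine through (1-y)(1 - x/(1-y)) = 1-x-y.\<close>
    have "((\<lambda>i. A n * (1 - y) powr (- s n) * (pochhammer (s n) i / fact i * (x / (1 - y)) ^ i)) has_sum
        A n * (1 - y) powr (- s n) * (1 - x / (1 - y)) powr (- s n)) UNIV"
      using xy s by (intro has_sum_cmult_right negative_binomial_has_sum) (auto simp: field_simps)
    moreover have "A n * (1 - y) powr (- s n) * (pochhammer (s n) i / fact i * (x / (1 - y)) ^ i) =
       A n * (pochhammer (s n) i / fact i * x ^ i) * (1 - y) powr (- (s n + i))" for i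
      using xy by (simp add: powr_diff powr_realpow power_divide)
    moreover have "(1 - y) powr (- s n) * (1 - x / (1 - y)) powr (- s n) = (1 - x - y) powr (- s n)"
    proof -
      have "(1 - y) * (1 - x / (1 - y)) = 1 - x - y" using xy by (simp add: field_simps)
      moreover have "1 - x / (1 - y) \<ge> 0" using xy by (simp add: field_simps)
      ultimately show ?thesis using xy powr_mult[of "1 - y" "1 - x / (1 - y)" "- s n"] by simp
    qed
    ultimately show "((\<lambda>i. A n * (pochhammer (s n) i / fact i * x ^ i) * (1 - y) powr (- (s n + i))) has_sum
        A n * (1 - x - y) powr (- s n)) UNIV"
      by (simp only: mult.assoc)
  qed
  also have "(\<lambda>n. A n * (1 - x - y) powr (- s n) / (fact n * fact (n + m))) =
      (\<lambda>n. pochhammer (1/2) (2 * n + m) * (a * b) ^ (2 * n + m) * (p\<^sup>2 - a\<^sup>2 - b\<^sup>2) powr (- (real (2 * n + m) + 1/2))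
            / (fact n * fact (n + m)))"
  proof
    fix n
    have "p ^ (2 * (2 * n + m) + 1) = p powr real (2 * (2 * n + m) + 1)"
      using p0 by (rule powr_realpow[symmetric])
    also have "real (2 * (2 * n + m) + 1) = 2 * s n" by (simp add: s_def)
    also have "p powr (2 * s n) = (p\<^sup>2) powr s n" using p0 powr_powr[of p 2 "s n"] by simp
    finally have "(1 - x - y) powr (- s n) / p ^ (2 * (2 * n + m) + 1) = (p\<^sup>2 - a\<^sup>2 - b\<^sup>2) powr (- s n)"
      using ident p0 by (simp add: xy(4) powr_divide powr_minus_divide)
    moreover have "A n * (1 - x - y) powr (- s n) / (fact n * fact (n + m)) =
        pochhammer (1/2) (2 * n + m) * (a * b) ^ (2 * n + m) * ((1 - x - y) powr (- s n) / p ^ (2 * (2 * n + m) + 1))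
            / (fact n * fact (n + m))"
      unfolding A_def by (simp only: times_divide_eq_left times_divide_eq_right)
    moreover have "- s n = - (real (2 * n + m) + 1/2)" by (simp add: s_def)
    ultimately show "A n * (1 - x - y) powr (- s n) / (fact n * fact (n + m)) =
        pochhammer (1/2) (2 * n + m) * (a * b) ^ (2 * n + m) * (p\<^sup>2 - a\<^sup>2 - b\<^sup>2) powr (- (real (2 * n + m) + 1/2))
            / (fact n * fact (n + m))"
      by (simp only:)
  qed
  finally show ?thesis .
qed

text \<open>With p^2 - a^2 - b^2 = 2abz, the duplication formula splits (m+1/2)_(2n) into the two
  Pochhammer symbols of the hypergeometric series for degree m - 1/2, and its 4^n cancels the one in
  (2z)^(2n).\<close>

lemma laplace_besselI_besselI:
  assumes a: "a > 0" and b: "b > 0" and p: "p > a + b"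
  shows "(\<integral>u. exp (- (p * u)) * besselI m (a * u) * besselI m (b * u) \<partial>halfline) =
    legendreQ (real m - 1/2) ((p\<^sup>2 - a\<^sup>2 - b\<^sup>2) / (2 * a * b)) / (pi * sqrt (a * b))"
proof -
  define z where "z = (p\<^sup>2 - a\<^sup>2 - b\<^sup>2) / (2 * a * b)"
  let ?I = "\<integral>u. exp (- (p * u)) * besselI m (a * u) * besselI m (b * u) \<partial>halfline"
  have "p\<^sup>2 > (a + b)\<^sup>2" using a b p by (intro power_strict_mono) auto
  moreover have ab: "a * b > 0" using a b by simp
  ultimately have pos: "p\<^sup>2 - a\<^sup>2 - b\<^sup>2 > 0" by (simp add: power2_eq_square algebra_simps)
  then have z: "z > 0" using a b by (simp add: z_def)
  have z_eq: "p\<^sup>2 - a\<^sup>2 - b\<^sup>2 = (a * b) * (2 * z)" using a b by (simp add: z_def field_simps)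
  \<comment> \<open>The prefactor of \<open>legendreQ\<close> at degree m - 1/2, its two powers
    merged, over the claimed pi sqrt(ab): it remains to see that the integral is \<open>c\<close>
    times the hypergeometric series.\<close>
  define c where "c = sqrt pi * Gamma (real m + 1/2) / ((2 * z) powr (real m + 1/2)) / (pi * sqrt (a * b))"
  let ?h = "\<lambda>n. pochhammer (real m / 2 + 3/4) n * pochhammer (real m / 2 + 1/4) n / (Gamma (real m + 1 + real n) * fact n) * (1 / z\<^sup>2) ^ n"
  let ?t = "\<lambda>n. pochhammer (1/2) (2 * n + m) * (a * b) ^ (2 * n + m) * (p\<^sup>2 - a\<^sup>2 - b\<^sup>2) powr (- (real (2 * n + m) + 1/2)) / (fact n * fact (n + m))"
  have Gamma_half: "Gamma (real m + 1/2) = sqrt pi * pochhammer (1/2) m"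
  proof -
    have "(1/2 :: real) \<notin> \<int>\<^sub>\<le>\<^sub>0" by (auto dest: nonpos_Ints_nonpos)
    then show ?thesis using pochhammer_Gamma[of "1/2 :: real" m] by (simp add: Gamma_one_half_real add.commute)
  qed
  have Gamma_half': "sqrt pi * Gamma (real m + 1/2) = pi * pochhammer (1/2) m"
    unfolding Gamma_half mult.assoc[symmetric] by simp
  have t_eq: "?t n = c * ?h n" for n
  proof -
    have "(a * b) ^ (2 * n + m) * (p\<^sup>2 - a\<^sup>2 - b\<^sup>2) powr (- (real (2 * n + m) + 1/2))
        = (a * b) powr real (2 * n + m) * ((a * b) powr (- (real (2 * n + m) + 1/2)) * (2 * z) powr (- (real (2 * n + m) + 1/2)))"
      unfolding z_eq using ab z by (simp only: powr_mult powr_realpow[symmetric])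
    also have "\<dots> = (a * b) powr (real (2 * n + m) + (- (real (2 * n + m) + 1/2))) * (2 * z) powr (- (real (2 * n + m) + 1/2))"
      by (simp only: powr_add mult.assoc)
    also have "real (2 * n + m) + (- (real (2 * n + m) + 1/2)) = - (1/2)" by simp
    also have "(a * b) powr (- (1/2)) = 1 / sqrt (a * b)"
      using ab by (simp add: powr_minus_divide powr_half_sqrt)
    also have "(2 * z) powr (- (real (2 * n + m) + 1/2)) = 1 / (2 * z) powr (real m + 1/2) * (1 / (4 ^ n * (z\<^sup>2) ^ n))"
    proof -
      have "- (real (2 * n + m) + 1/2) = - (real m + 1/2) + - real (2 * n)" by simp
      then show ?thesis
        using z by (simp only: powr_add powr_minus_divide powr_realpow zero_less_mult_iff zero_less_numeral simp_thms power_mult power_mult_distrib) simp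
    qed
    finally have 1: "(a * b) ^ (2 * n + m) * (p\<^sup>2 - a\<^sup>2 - b\<^sup>2) powr (- (real (2 * n + m) + 1/2)) =
        1 / sqrt (a * b) * (1 / (2 * z) powr (real m + 1/2) * (1 / (4 ^ n * (z\<^sup>2) ^ n)))" .
    have "pochhammer (2 * (real m / 2 + 1/4)) (2 * n) = 4 ^ n * (pochhammer (real m / 2 + 1/4) n * pochhammer (real m / 2 + 1/4 + 1/2) n)"
      by (subst pochhammer_double) (simp add: power_mult)
    then have "pochhammer (1/2 + real m) (2 * n) = 4 ^ n * (pochhammer (real m / 2 + 3/4) n * pochhammer (real m / 2 + 1/4) n)"
      by (simp add: algebra_simps)
    then have 2: "pochhammer (1/2) (2 * n + m) = pochhammer (1/2 :: real) m * (4 ^ n * (pochhammer (real m / 2 + 3/4) n * pochhammer (real m / 2 + 1/4) n))"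
      using pochhammer_product'[of "1/2 :: real" m "2 * n"] by (simp add: add.commute)
    have 3: "Gamma (real m + 1 + real n) = fact (n + m)"
      by (simp add: Gamma_fact[symmetric] add_ac)
    show ?thesis
      unfolding mult.assoc[of "pochhammer (1/2) (2 * n + m)"] 1
      unfolding 2 3 c_def Gamma_half'
      using z ab by (simp add: power_divide mult_ac)
  qed
  have "(?t has_sum ?I) UNIV" by (rule laplace_besselI_besselI_has_sum[OF a b p])
  then have "(\<lambda>n. c * ?h n) sums ?I" unfolding t_eq by (rule has_sum_imp_sums)
  \<comment> \<open>As \<open>c\<close> is nonzero, convergence of the hypergeometric series is
    inherited from the series for the integral.\<close>
  moreover have c: "c \<noteq> 0"
    using z ab by (simp add: c_def Gamma_half pochhammer_eq_0_iff) (auto simp: field_simps)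
  ultimately have "?h sums (?I / c)" by (rule sums_mult_D)
  then have "hyp2F1reg (real m / 2 + 3/4) (real m / 2 + 1/4) (real m + 1) (1 / z\<^sup>2) = ?I / c"
    unfolding hyp2F1reg_def by (simp only: sums_iff)
  moreover have "(real m - 1/2) / 2 + 1 = real m / 2 + 3/4" "(real m - 1/2 + 1) / 2 = real m / 2 + 1/4"
      "(real m - 1/2) + 3/2 = real m + 1" "real m - 1/2 + 1 = real m + 1/2"
    by (auto simp: field_simps)
  ultimately have "legendreQ (real m - 1/2) z = sqrt pi * Gamma (real m + 1/2) / (2 powr (real m + 1/2) * z powr (real m + 1/2)) * (?I / c)"
    unfolding legendreQ_def by (simp only:)
  also have "2 powr (real m + 1/2) * z powr (real m + 1/2) = (2 * z) powr (real m + 1/2)"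
    using z by (simp add: powr_mult)
  also have "sqrt pi * Gamma (real m + 1/2) / (2 * z) powr (real m + 1/2) = c * (pi * sqrt (a * b))"
    using a b by (simp add: c_def)
  finally show ?thesis using c a b unfolding z_def[symmetric] by simp
qed

section \<open>Weber's second exponential integral\<close>

text \<open>The odd Gaussian moment N!/(2 s^(N+1)) supplies the Vandermonde numerator N! directly.
  Both inner sums are now exponential series, and the series of J_m(kr) is left over.\<close>

lemma weber_integral:
  assumes s: "s > 0" and r: "r > 0" and k: "k > 0"
  shows "(\<integral>x. exp (- (s * x\<^sup>2)) * besselI m (2 * s * r * x) * besselJ m (k * x) * x \<partial>halfline) =
    exp (s * r\<^sup>2) * exp (- (k\<^sup>2 / (4 * s))) * besselJ m (k * r) / (2 * s)"
proof -
  define f where "f = (\<lambda>(j, l) x. exp (- (s * x\<^sup>2)) * x *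
     (((2 * s * r * x) / 2) ^ (2 * j + m) / (fact j * fact (j + m)) * ((-1) ^ l * ((k * x) / 2) ^ (2 * l + m) / (fact l * fact (l + m)))))"
  define w where "w = (\<lambda>j l. (s * r) ^ (2 * j + m) * (-1) ^ l * (k / 2) ^ (2 * l + m) / (2 * s ^ Suc (j + l + m)))"
  let ?I = "\<lambda>x. exp (- (s * x\<^sup>2)) * x * (besselI m (2 * s * r * x) * besselJ m (k * x))"
  \<comment> \<open>The dominating function: for positive arguments the absolute values of the terms
    of J_m sum to I_m.\<close>
  let ?H = "\<lambda>x. exp (- (s * x\<^sup>2)) * x * (besselI m (2 * s * r * x) * besselI m (k * x))"
  have f_sum: "((\<lambda>i. f i x) has_sum ?I x) UNIV" for x
    using has_sum_cmult_right[OF has_sum_product_real[OF besselI_has_sum[of "2 * s * r * x" m] besselJ_has_sum[of "k * x" m]], of "exp (- (s * x\<^sup>2)) * x"]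
    by (simp add: f_def case_prod_unfold mult.assoc)
  have f_abs: "((\<lambda>i. \<bar>f i x\<bar>) has_sum ?H x) UNIV" if "x \<in> space halfline" for x
  proof -
    have x: "x > 0" using that by (simp add: space_restrict_space)
    have "\<bar>f i x\<bar> = exp (- (s * x\<^sup>2)) * x * (case i of (j, l) \<Rightarrow>
     ((2 * s * r * x) / 2) ^ (2 * j + m) / (fact j * fact (j + m)) * (((k * x) / 2) ^ (2 * l + m) / (fact l * fact (l + m))))" for i
      using x s r k by (cases i) (simp add: f_def abs_mult power_abs)
    then show ?thesis
      using has_sum_cmult_right[OF has_sum_product_real[OF besselI_has_sum[of "2 * s * r * x" m] besselI_has_sum[of "k * x" m]], of "exp (- (s * x\<^sup>2)) * x"]
      by (simp only: UNIV_Times_UNIV)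
  qed
  \<comment> \<open>The joint growth rate of the two modified Bessel functions; completing the
    square absorbs exp(d x) at the cost of half the Gaussian exponent.\<close>
  define d where "d = 2 * s * r + k"
  have int_H: "integrable halfline ?H"
  proof (rule Bochner_Integration.integrable_bound)
    show "integrable halfline (\<lambda>x. exp (d\<^sup>2 / (2 * s)) * (x ^ (2 * 0 + 1) * exp (- ((s / 2) * x\<^sup>2))))"
      using has_bochner_integral_odd_power_gaussian[of "s / 2" 0] s
      by (intro integrable_mult_right) (auto simp: has_bochner_integral_iff)
    show "AE x in halfline. norm (?H x) \<le> norm (exp (d\<^sup>2 / (2 * s)) * (x ^ (2 * 0 + 1) * exp (- ((s / 2) * x\<^sup>2))))"
    proof (rule AE_I2)
      fix x assume "x \<in> space halfline"
      then have x: "x > 0" by (simp add: space_restrict_space)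
      have "0 \<le> (s * x - d)\<^sup>2 / (2 * s)" using s by simp
      also have "\<dots> = s / 2 * x\<^sup>2 - d * x + d\<^sup>2 / (2 * s)" using s by (simp add: field_simps power2_eq_square)
      finally have *: "- (s * x\<^sup>2) + d * x \<le> d\<^sup>2 / (2 * s) + - ((s / 2) * x\<^sup>2)" by (simp add: field_simps)
      have "?H x \<le> exp (- (s * x\<^sup>2)) * x * (exp (2 * s * r * x) * exp (k * x))"
        using x s r k by (intro mult_mono besselI_le_exp besselI_nonneg mult_nonneg_nonneg) auto
      also have "\<dots> = x * exp (- (s * x\<^sup>2) + d * x)"
        by (simp add: d_def mult_exp_exp distrib_right add.assoc)
      also have "\<dots> \<le> x * exp (d\<^sup>2 / (2 * s) + - ((s / 2) * x\<^sup>2))"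
        using * x by (intro mult_left_mono) auto
      also have "\<dots> = exp (d\<^sup>2 / (2 * s)) * (x ^ (2 * 0 + 1) * exp (- ((s / 2) * x\<^sup>2)))"
        unfolding exp_add by simp
      finally show "norm (?H x) \<le> norm (exp (d\<^sup>2 / (2 * s)) * (x ^ (2 * 0 + 1) * exp (- ((s / 2) * x\<^sup>2))))"
        using x s r k by (simp add: abs_mult besselI_nonneg)
    qed
  qed measurable
  have int_f: "(\<integral>x. f (j, l) x \<partial>halfline) =
      fact (j + l + m) / (fact j * fact (j + m) * fact l * fact (l + m)) * w j l" for j l
  proof -
    let ?N = "j + l + m"
    have "f (j, l) x = (s * r) ^ (2 * j + m) * (-1) ^ l * (k / 2) ^ (2 * l + m) / (fact j * fact (j + m) * fact l * fact (l + m))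
            * (x ^ (2 * ?N + 1) * exp (- (s * x\<^sup>2)))" for x
    proof -
      have x_pow: "x ^ (2 * ?N + 1) = x * x ^ (2 * j + m) * x ^ (2 * l + m)"
      proof -
        have "x ^ (2 * ?N + 1) = x ^ (1 + (2 * j + m) + (2 * l + m))" by (rule arg_cong[where f = "power x"]) simp
        then show ?thesis by (simp only: power_add power_one_right)
      qed
      have half: "(2 * s * r * x) / 2 = (s * r) * x" "(k * x) / 2 = (k / 2) * x" by auto
      show ?thesis
        unfolding f_def prod.case half power_mult_distrib[of _ x] x_pow
        by (simp only: mult_ac times_divide_eq_left times_divide_eq_right divide_divide_eq_left)
    qed
    then have "(\<integral>x. f (j, l) x \<partial>halfline) = (s * r) ^ (2 * j + m) * (-1) ^ l * (k / 2) ^ (2 * l + m) / (fact j * fact (j + m) * fact l * fact (l + m))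
       * (fact ?N / (2 * s ^ Suc ?N))"
      using has_bochner_integral_odd_power_gaussian[OF s, of ?N] by (simp add: has_bochner_integral_iff)
    then show ?thesis by (simp add: w_def mult_ac)
  qed
  have "((\<lambda>i. \<integral>x. f i x \<partial>halfline) has_sum (\<integral>x. ?I x \<partial>halfline)) UNIV"
  proof (rule has_sum_integral[OF _ int_H])
    show "f i \<in> borel_measurable halfline" for i
      by (cases i) (simp add: f_def, measurable)
  qed (use f_sum f_abs in auto)
  also have "(\<lambda>i. \<integral>x. f i x \<partial>halfline) = (\<lambda>(j, l). fact (j + l + m) / (fact j * fact (j + m) * fact l * fact (l + m)) * w j l)"
    using int_f by auto
  finally have dbl: "((\<lambda>(j, l). fact (j + l + m) / (fact j * fact (j + m) * fact l * fact (l + m)) * w j l) has_sum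
      (\<integral>x. ?I x \<partial>halfline)) UNIV" .
  \<comment> \<open>The exponents produced by the sums over i and i'. The sign (-1)^i' from J_m
    makes \<open>y\<close> negative, while (-1)^n stays in \<open>A n\<close> and builds
    J_m(kr).\<close>
  define x y where "x = s * r\<^sup>2" and "y = - (k\<^sup>2 / (4 * s))"
  define A where "A = (\<lambda>n. (-1) ^ n * (k * r / 2) ^ (2 * n + m) / (2 * s))"
  have w_eq: "w (n + i) (n + i') / (fact i * fact i') = A n * (x ^ i / fact i) * (y ^ i' / fact i')" for n i i'
  proof -
    have pow: "c ^ (2 * (n + i) + m) = c ^ (2 * n + m) * (c\<^sup>2) ^ i" for c :: real and i
      unfolding power_mult[symmetric] power_add[symmetric] by (rule arg_cong[where f = "power c"]) simp
    have s_pow: "s ^ Suc (n + i + (n + i') + m) = s ^ (2 * n + m) * s ^ i * s ^ i' * s"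
      by (simp add: power_add mult_2)
    have x_eq: "x ^ i = (s * s * r\<^sup>2) ^ i / s ^ i" and y_eq: "y ^ i' = (-1) ^ i' * ((k / 2)\<^sup>2) ^ i' / s ^ i'"
      using s by (simp_all add: x_def y_def power_divide power_mult_distrib power_minus[of "_ / _"])
    have A_eq: "A n = (-1) ^ n * (s * r) ^ (2 * n + m) * (k / 2) ^ (2 * n + m) / (2 * s) / s ^ (2 * n + m)"
      using s by (simp add: A_def power_mult_distrib power_divide)
    show ?thesis
      unfolding w_def pow s_pow x_eq y_eq A_eq power_add[of "-1"]
      using s by (simp add: power2_eq_square mult_ac)
  qed
  have exp_has_sum: "((\<lambda>i. t ^ i / fact i) has_sum exp t) UNIV" for t :: real
    using exp_converges[of t] summable_norm_exp[of t]
    by (intro norm_summable_imp_has_sum) (simp_all add: divide_inverse mult_ac)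
  have "((\<lambda>n. A n * exp x * exp y / (fact n * fact (n + m))) has_sum (\<integral>x. ?I x \<partial>halfline)) UNIV"
  proof (rule vandermonde_resummation[OF dbl])
    show "((\<lambda>i'. w (n + i) (n + i') / (fact i * fact i')) has_sum A n * (x ^ i / fact i) * exp y) UNIV" for n i
      unfolding w_eq by (intro has_sum_cmult_right exp_has_sum)
    show "((\<lambda>i. A n * (x ^ i / fact i) * exp y) has_sum A n * exp x * exp y) UNIV" for n
      by (intro has_sum_cmult_left has_sum_cmult_right exp_has_sum)
  qed
  moreover have "((\<lambda>n. A n * exp x * exp y / (fact n * fact (n + m))) has_sum exp x * exp y * besselJ m (k * r) / (2 * s)) UNIV"
    using has_sum_cmult_right[OF besselJ_has_sum[of "k * r" m], of "exp x * exp y / (2 * s)"]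
    by (simp add: A_def mult_ac)
  ultimately show ?thesis
    using has_sum_unique by (force simp: x_def y_def mult_ac)
qed

section \<open>The integral representation of the product of both modified Bessel functions\<close>

text \<open>The mean value inequality bounds the difference quotients by \<open>w\<close>, so
  dominated convergence applies along every sequence. Derivatives within \<open>S\<close> allow the
  endpoint 0 of an interval.\<close>

lemma has_field_derivative_lebesgue_integral:
  fixes f f' :: "real \<Rightarrow> 'a \<Rightarrow> real"
  assumes S: "convex S" "x \<in> S"
    and deriv: "\<And>y t. y \<in> S \<Longrightarrow> t \<in> space M \<Longrightarrow> ((\<lambda>y. f y t) has_field_derivative f' y t) (at y within S)"
    and int: "\<And>y. y \<in> S \<Longrightarrow> integrable M (f y)"
    and meas: "f' x \<in> borel_measurable M"
    and w: "integrable M w"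
    and bound: "\<And>y t. y \<in> S \<Longrightarrow> t \<in> space M \<Longrightarrow> \<bar>f' y t\<bar> \<le> w t"
  shows "((\<lambda>y. \<integral>t. f y t \<partial>M) has_field_derivative (\<integral>t. f' x t \<partial>M)) (at x within S)"
  unfolding has_field_derivative_iff tendsto_at_iff_sequentially
proof (intro allI impI)
  fix X :: "nat \<Rightarrow> real"
  assume X: "\<forall>i. X i \<in> S - {x}" "X \<longlonglongrightarrow> x"
  have "(\<lambda>n. \<integral>t. (f (X n) t - f x t) / (X n - x) \<partial>M) \<longlonglongrightarrow> (\<integral>t. f' x t \<partial>M)"
  proof (rule integral_dominated_convergence[OF meas _ w])
    show "(\<lambda>t. (f (X n) t - f x t) / (X n - x)) \<in> borel_measurable M" for n
      using int[of "X n"] int[of x] X S by (auto intro!: borel_measurable_divide borel_measurable_diff)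
    show "AE t in M. (\<lambda>n. (f (X n) t - f x t) / (X n - x)) \<longlonglongrightarrow> f' x t"
    proof (rule AE_I2)
      fix t assume "t \<in> space M"
      from deriv[OF S(2) this] X show "(\<lambda>n. (f (X n) t - f x t) / (X n - x)) \<longlonglongrightarrow> f' x t"
        unfolding has_field_derivative_iff tendsto_at_iff_sequentially by (auto simp: o_def)
    qed
    show "AE t in M. norm ((f (X n) t - f x t) / (X n - x)) \<le> w t" for n
    proof (rule AE_I2)
      fix t assume t: "t \<in> space M"
      have "norm (f (X n) t - f x t) \<le> w t * norm (X n - x)"
        by (rule field_differentiable_bound[OF S(1), of "\<lambda>y. f y t" "\<lambda>y. f' y t"])
           (use deriv bound t X S in auto)
      then show "norm ((f (X n) t - f x t) / (X n - x)) \<le> w t"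
        using X by (simp add: divide_le_eq)
    qed
  qed
  moreover have "(\<integral>t. (f (X n) t - f x t) / (X n - x) \<partial>M) = ((\<integral>t. f (X n) t \<partial>M) - (\<integral>t. f x t \<partial>M)) / (X n - x)" for n
    using int[of "X n"] int[of x] X S by simp
  ultimately show "((\<lambda>y. ((\<integral>t. f y t \<partial>M) - (\<integral>t. f x t \<partial>M)) / (y - x)) \<circ> X) \<longlonglongrightarrow> (\<integral>t. f' x t \<partial>M)"
    by (simp only: o_def)
qed

text \<open>Serves to turn an exact derivative with vanishing boundary values into a differential
  equation for a parameter integral.\<close>

lemma integral_halfline_derivative_eq_0:
  fixes F f :: "real \<Rightarrow> real"
  assumes deriv: "\<And>u. u > 0 \<Longrightarrow> (F has_field_derivative f u) (at u)"
    and cont: "continuous_on {0<..} f"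
    and int: "integrable halfline f"
    and lim: "(F \<longlongrightarrow> 0) (at_right 0)" "(F \<longlongrightarrow> 0) at_top"
  shows "(\<integral>u. f u \<partial>halfline) = 0"
proof -
  have set_int: "set_integrable lborel {0<..} f"
    using int unfolding set_integrable_def by (subst (asm) integrable_restrict_space) auto
  have "(LBINT u=0..\<infinity>. f u) = 0 - 0"
  proof (rule interval_integral_FTC_integrable[where F = F])
    show "(F has_vector_derivative f u) (at u)" if "0 < ereal u" for u
      using deriv that by (simp add: has_real_derivative_iff_has_vector_derivative)
    show "isCont f u" if "0 < ereal u" for u
      using cont that by (simp add: continuous_on_eq_continuous_at)
    show "set_integrable lborel (einterval 0 \<infinity>) f"
      using set_int by (simp add: zero_ereal_def)
    show "((F \<circ> real_of_ereal) \<longlongrightarrow> 0) (at_right 0)"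
      using lim(1) by (simp add: zero_ereal_def ereal_tendsto_simps)
    show "((F \<circ> real_of_ereal) \<longlongrightarrow> 0) (at_left \<infinity>)"
      using lim(2) by (simp add: ereal_tendsto_simps)
  qed auto
  then show ?thesis
    by (simp add: interval_lebesgue_integral_0_infty set_lebesgue_integral_def integral_restrict_space)
qed

text \<open>The combined exponent u(x+b) - 2u sqrt(xb) is u (sqrt b - sqrt x)^2, so the decay is
  uniform for x up to c < b. This provides majorants for differentiation in x.\<close>

lemma exp_mult_bclifford_le:
  assumes "0 \<le> x" "x \<le> c" "c < b" "u > 0"
  shows "exp (- (u * (x + b))) * bclifford n (u\<^sup>2 * x * b) \<le> exp (- ((sqrt b - sqrt c)\<^sup>2 * u))"
proof -
  have "u\<^sup>2 * x * b = (u * sqrt x * sqrt b)\<^sup>2" using assms by (simp add: power_mult_distrib)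
  then have "bclifford n (u\<^sup>2 * x * b) \<le> exp (2 * (u * sqrt x * sqrt b))"
    using bclifford_le_exp[of "u * sqrt x * sqrt b" n] assms by simp
  then have "exp (- (u * (x + b))) * bclifford n (u\<^sup>2 * x * b) \<le> exp (- (u * (x + b))) * exp (2 * (u * sqrt x * sqrt b))"
    by (intro mult_left_mono) auto
  also have "\<dots> = exp (- ((sqrt b - sqrt x)\<^sup>2 * u))"
  proof -
    have "(sqrt b - sqrt x)\<^sup>2 = x + b - 2 * (sqrt x * sqrt b)" using assms by (simp add: power2_diff)
    then have "- (u * (x + b)) + 2 * (u * sqrt x * sqrt b) = - ((sqrt b - sqrt x)\<^sup>2 * u)"
      by (simp only:) (simp add: algebra_simps)
    then show ?thesis by (simp only: mult_exp_exp)
  qed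
  also have "\<dots> \<le> exp (- ((sqrt b - sqrt c)\<^sup>2 * u))"
  proof -
    have "(sqrt b - sqrt c)\<^sup>2 \<le> (sqrt b - sqrt x)\<^sup>2"
      using assms by (intro power_mono) auto
    then show ?thesis using assms by (simp add: mult_right_mono)
  qed
  finally show ?thesis .
qed

text \<open>From t <= exp t at t = \<kappa>/u; it keeps the weight bounded near 0 despite the factor
  1/u, also for order 0.\<close>

lemma exp_neg_divide_le:
  fixes \<kappa> u :: real
  assumes "\<kappa> > 0" "u > 0"
  shows "exp (- (\<kappa> / u)) / u \<le> 1 / \<kappa>"
proof -
  have "\<kappa> / u \<le> exp (\<kappa> / u)" using exp_ge_add_one_self[of "\<kappa> / u"] by linarith
  then show ?thesis using assms by (simp add: exp_minus field_simps)
qed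

text \<open>In x both sides solve x y'' + (m+1) y' = \<kappa> y and are regular at 0, so their
  Wronskian vanishes and they are proportional; x = 0 fixes the constant. In the application x and b
  are the squares of the smaller and the larger of the two radii.\<close>

lemma integral_exp_bclifford:
  assumes \<kappa>: "\<kappa> > 0" and x: "0 \<le> x" "x < b"
  shows "(\<integral>u. u ^ m * (exp (- (\<kappa> / u)) / u) * (exp (- (u * (x + b))) * bclifford m (u\<^sup>2 * x * b)) \<partial>halfline) =
    bclifford m (\<kappa> * x) * (\<integral>u. u ^ m * (exp (- (\<kappa> / u)) / u) * exp (- (u * b)) \<partial>halfline)"
proof -
  define S where "S = {0..x}"
  \<comment> \<open>A decay rate valid for all y in \<open>S\<close> at once.\<close>
  define \<delta> where "\<delta> = (sqrt b - sqrt x)\<^sup>2"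
  have \<delta>: "\<delta> > 0" using x by (simp add: \<delta>_def)
  have b: "b > 0" using x by simp
  have S: "convex S" "0 \<in> S" "x \<in> S" using x by (auto simp: S_def)
  define \<omega> where "\<omega> = (\<lambda>u. u ^ m * (exp (- (\<kappa> / u)) / u))"
  \<comment> \<open>The first argument counts the shift of the order: the y-derivative of
    \<open>e n\<close> is u^2 b \<open>e (n+1)\<close> - u \<open>e n\<close>. Hence
    \<open>f1\<close> and \<open>f2\<close> are the first two y-derivatives of
    \<open>f0\<close>.\<close>
  define e where "e = (\<lambda>n y u. exp (- (u * (y + b))) * bclifford (n + m) (u\<^sup>2 * y * b))"
  define f0 where "f0 = (\<lambda>y u. \<omega> u * e 0 y u)"
  define f1 where "f1 = (\<lambda>y u. \<omega> u * (u\<^sup>2 * b * e 1 y u - u * e 0 y u))"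
  define f2 where "f2 = (\<lambda>y u. \<omega> u * (u\<^sup>2 * b * (u\<^sup>2 * b * e 2 y u - u * e 1 y u) - u * (u\<^sup>2 * b * e 1 y u - u * e 0 y u)))"
  have [measurable]: "\<omega> \<in> borel_measurable borel" "e n y \<in> borel_measurable borel" for n y
    unfolding \<omega>_def e_def by measurable
  have e_nonneg: "e n y u \<ge> 0" if "y \<in> S" for n y u
    using that x by (auto simp: e_def S_def bclifford_nonneg)
  have e_le: "e n y u \<le> exp (- (\<delta> * u))" if "y \<in> S" "u > 0" for n y u
    unfolding e_def \<delta>_def using that x by (intro exp_mult_bclifford_le) (auto simp: S_def)
  have \<omega>_nonneg: "\<omega> u \<ge> 0" if "u > 0" for u using that by (simp add: \<omega>_def)
  have \<omega>_le: "\<omega> u \<le> u ^ m * (1 / \<kappa>)" if "u > 0" for u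
    unfolding \<omega>_def using that \<kappa> by (intro mult_left_mono exp_neg_divide_le) auto
  have \<omega>e_le: "\<bar>\<omega> u * e n y u\<bar> \<le> 1 / \<kappa> * (u ^ m * exp (- (\<delta> * u)))" if "y \<in> S" "u > 0" for n y u
  proof -
    have "\<omega> u * e n y u \<le> (u ^ m * (1 / \<kappa>)) * exp (- (\<delta> * u))"
      using that \<omega>_le e_le \<kappa> e_nonneg by (intro mult_mono) auto
    then show ?thesis using \<omega>_nonneg[OF that(2)] e_nonneg[OF that(1)] by (simp add: abs_of_nonneg)
  qed
  \<comment> \<open>Majorant of every term with factor u^n, whatever the order of its
    Bessel-Clifford function and whatever y in \<open>S\<close>.\<close>
  define W where "W = (\<lambda>n u. 1 / \<kappa> * (u ^ (n + m) * exp (- (\<delta> * u))))"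
  have int_W: "integrable halfline (W n)" for n
    unfolding W_def using has_bochner_integral_power_exp[OF \<delta>, of "n + m"]
    by (intro integrable_mult_right) (auto simp: has_bochner_integral_iff)
  have mono_le: "\<bar>\<omega> u * (u ^ k * e n y u)\<bar> \<le> W k u" if "y \<in> S" "u > 0" for k n y u
  proof -
    have "\<bar>\<omega> u * (u ^ k * e n y u)\<bar> = u ^ k * \<bar>\<omega> u * e n y u\<bar>" using that by (simp add: abs_mult)
    also have "\<dots> \<le> u ^ k * (1 / \<kappa> * (u ^ m * exp (- (\<delta> * u))))"
      using that by (intro mult_left_mono \<omega>e_le) auto
    finally show ?thesis by (simp add: W_def power_add mult_ac)
  qed
  have pos: "u > 0" if "u \<in> space halfline" for u using that by (simp add: space_restrict_space)
  have f0_le: "\<bar>f0 y u\<bar> \<le> W 0 u" if "y \<in> S" "u > 0" for y u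
    using mono_le[OF that, of 0 0] by (simp add: f0_def)
  have f1_eq: "f1 y u = b * (\<omega> u * (u ^ 2 * e 1 y u)) - \<omega> u * (u ^ 1 * e 0 y u)" for y u
    by (simp add: f1_def algebra_simps)
  have f2_eq: "f2 y u = b\<^sup>2 * (\<omega> u * (u ^ 4 * e 2 y u)) - 2 * b * (\<omega> u * (u ^ 3 * e 1 y u)) + \<omega> u * (u ^ 2 * e 0 y u)" for y u
    by (simp add: f2_def algebra_simps eval_nat_numeral)
  have f1_le: "\<bar>f1 y u\<bar> \<le> b * W 2 u + W 1 u" if "y \<in> S" "u > 0" for y u
  proof -
    have "\<bar>f1 y u\<bar> \<le> \<bar>b * (\<omega> u * (u ^ 2 * e 1 y u))\<bar> + \<bar>\<omega> u * (u ^ 1 * e 0 y u)\<bar>"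
      unfolding f1_eq by (rule abs_triangle_ineq4)
    also have "\<dots> \<le> b * W 2 u + W 1 u"
      using b by (subst abs_mult[of b]) (intro add_mono mult_mono mono_le that; auto)
    finally show ?thesis .
  qed
  have f2_le: "\<bar>f2 y u\<bar> \<le> b\<^sup>2 * W 4 u + 2 * b * W 3 u + W 2 u" if "y \<in> S" "u > 0" for y u
  proof -
    have "\<bar>f2 y u\<bar> \<le> \<bar>b\<^sup>2 * (\<omega> u * (u ^ 4 * e 2 y u))\<bar> + \<bar>2 * b * (\<omega> u * (u ^ 3 * e 1 y u))\<bar> + \<bar>\<omega> u * (u ^ 2 * e 0 y u)\<bar>"
      unfolding f2_eq by linarith
    also have "\<dots> \<le> b\<^sup>2 * W 4 u + 2 * b * W 3 u + W 2 u"
      using b by (subst abs_mult[of "b\<^sup>2"], subst abs_mult[of "2 * b"]) (intro add_mono mult_mono mono_le that; auto)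
    finally show ?thesis .
  qed
  have meas: "f0 y \<in> borel_measurable halfline" "f1 y \<in> borel_measurable halfline" "f2 y \<in> borel_measurable halfline" for y
    unfolding f0_def f1_def f2_def by measurable
  have int0: "integrable halfline (f0 y)" and int1: "integrable halfline (f1 y)" and int2: "integrable halfline (f2 y)" if "y \<in> S" for y
  proof -
    show "integrable halfline (f0 y)"
      by (rule Bochner_Integration.integrable_bound[OF int_W meas(1)]) (rule AE_I2, unfold real_norm_def, rule order_trans[OF f0_le[OF that pos] abs_ge_self])
    show "integrable halfline (f1 y)"
    proof (rule Bochner_Integration.integrable_bound[OF _ meas(2)])
      show "integrable halfline (\<lambda>u. b * W 2 u + W 1 u)"
        using int_W by (intro Bochner_Integration.integrable_add integrable_mult_right) auto
    qed (rule AE_I2, unfold real_norm_def, rule order_trans[OF f1_le[OF that pos] abs_ge_self])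
    show "integrable halfline (f2 y)"
    proof (rule Bochner_Integration.integrable_bound[OF _ meas(3)])
      show "integrable halfline (\<lambda>u. b\<^sup>2 * W 4 u + 2 * b * W 3 u + W 2 u)"
        using int_W by (intro Bochner_Integration.integrable_add integrable_mult_right) auto
    qed (rule AE_I2, unfold real_norm_def, rule order_trans[OF f2_le[OF that pos] abs_ge_self])
  qed
  have e_deriv: "((\<lambda>y. e n y u) has_field_derivative u\<^sup>2 * b * e (Suc n) y u - u * e n y u) (at y within T)" for n y u T
    unfolding e_def by (auto intro!: derivative_eq_intros simp: mult_ac)
  define \<Phi>0 where "\<Phi>0 = (\<lambda>y. \<integral>u. f0 y u \<partial>halfline)"
  define \<Phi>1 where "\<Phi>1 = (\<lambda>y. \<integral>u. f1 y u \<partial>halfline)"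
  define \<Phi>2 where "\<Phi>2 = (\<lambda>y. \<integral>u. f2 y u \<partial>halfline)"
  have \<Phi>0_deriv: "(\<Phi>0 has_field_derivative \<Phi>1 y) (at y within S)" if "y \<in> S" for y
    unfolding \<Phi>0_def \<Phi>1_def
  proof (rule has_field_derivative_lebesgue_integral[OF S(1) that _ int0 meas(2)])
    show "((\<lambda>y. f0 y u) has_field_derivative f1 y u) (at y within S)" for y u
      unfolding f0_def f1_def using e_deriv[of 0] by (auto intro!: derivative_eq_intros)
    show "integrable halfline (\<lambda>u. b * W 2 u + W 1 u)"
      using int_W by (intro Bochner_Integration.integrable_add integrable_mult_right) auto
  qed (use f1_le pos in auto)
  have \<Phi>1_deriv: "(\<Phi>1 has_field_derivative \<Phi>2 y) (at y within S)" if "y \<in> S" for y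
    unfolding \<Phi>1_def \<Phi>2_def
  proof (rule has_field_derivative_lebesgue_integral[OF S(1) that _ int1 meas(3)])
    show "((\<lambda>y. f1 y u) has_field_derivative f2 y u) (at y within S)" for y u
      unfolding f1_def f2_def using e_deriv[of 0] e_deriv[of 1]
      by (auto intro!: derivative_eq_intros simp: eval_nat_numeral)
    show "integrable halfline (\<lambda>u. b\<^sup>2 * W 4 u + 2 * b * W 3 u + W 2 u)"
      using int_W by (intro Bochner_Integration.integrable_add integrable_mult_right) auto
  qed (use f2_le pos in auto)
  \<comment> \<open>The integrand of the differential expression is an exact derivative in \<open>u\<close>, because
    \<open>u ^ (m + 1) * e 0 y u\<close> solves a heat equation in the time variable \<open>1 / u\<close>.\<close>
  have ode: "y * \<Phi>2 y + (real m + 1) * \<Phi>1 y = \<kappa> * \<Phi>0 y" if y: "y \<in> S" for y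
  proof -
    define F where "F = (\<lambda>u. u ^ (m + 1) * (exp (- (\<kappa> / u)) * e 0 y u))"
    let ?h = "\<lambda>u. y * f2 y u + (real m + 1) * f1 y u - \<kappa> * f0 y u"
    have "(\<integral>u. - ?h u \<partial>halfline) = 0"
    proof (rule integral_halfline_derivative_eq_0[where F = F])
      fix u :: real assume u: "u > 0"
      \<comment> \<open>The recurrence eliminates \<open>e 2\<close>; the remaining terms in
        \<open>e 0\<close> and \<open>e 1\<close> match the derivative of \<open>F\<close>.\<close>
      have rec: "u\<^sup>2 * y * b * e 2 y u + (real m + 1) * e 1 y u = e 0 y u"
        unfolding e_def add_0 bclifford_recurrence[of "u\<^sup>2 * y * b" m, symmetric]
        by (simp add: numeral_2_eq_2 distrib_left[of "exp _"])
      have d0: "((\<lambda>u. e 0 y u) has_field_derivative 2 * u * y * b * e 1 y u - (y + b) * e 0 y u) (at u)"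
        unfolding e_def by (auto intro!: derivative_eq_intros simp: algebra_simps)
      have d1: "((\<lambda>u. u ^ (m + 1)) has_field_derivative (real m + 1) * u ^ m) (at u)"
        using DERIV_pow[of "m + 1" u] by (simp add: add.commute)
      have d2: "((\<lambda>u. exp (- (\<kappa> / u))) has_field_derivative exp (- (\<kappa> / u)) * (\<kappa> / u\<^sup>2)) (at u)"
        using u by (auto intro!: derivative_eq_intros simp: power2_eq_square)
      have "(F has_field_derivative
          (real m + 1) * u ^ m * (exp (- (\<kappa> / u)) * e 0 y u) +
          u ^ (m + 1) * (exp (- (\<kappa> / u)) * (2 * u * y * b * e 1 y u - (y + b) * e 0 y u) + exp (- (\<kappa> / u)) * (\<kappa> / u\<^sup>2) * e 0 y u)) (at u)"
        unfolding F_def by (rule DERIV_cong[OF DERIV_mult[OF d1 DERIV_mult[OF d2 d0]]]) (simp add: algebra_simps)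
      moreover have "(real m + 1) * u ^ m * (exp (- (\<kappa> / u)) * e 0 y u) +
          u ^ (m + 1) * (exp (- (\<kappa> / u)) * (2 * u * y * b * e 1 y u - (y + b) * e 0 y u) + exp (- (\<kappa> / u)) * (\<kappa> / u\<^sup>2) * e 0 y u)
          = \<omega> u * (u * (real m + 1) * e 0 y u + u\<^sup>2 * (2 * u * y * b * e 1 y u - (y + b) * e 0 y u) + \<kappa> * e 0 y u)"
        using u by (simp add: \<omega>_def field_simps power2_eq_square)
      moreover have "- ?h u = \<omega> u * (u * (real m + 1) * e 0 y u + u\<^sup>2 * (2 * u * y * b * e 1 y u - (y + b) * e 0 y u) + \<kappa> * e 0 y u)"
      proof -
        have "- ?h u = \<omega> u * (- (u\<^sup>2 * b * (u\<^sup>2 * y * b * e 2 y u + (real m + 1) * e 1 y u)) + 2 * u * u\<^sup>2 * y * b * e 1 y u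
             - u\<^sup>2 * y * e 0 y u + u * (real m + 1) * e 0 y u + \<kappa> * e 0 y u)"
          unfolding f0_def f1_def f2_def by (simp add: algebra_simps power2_eq_square)
        then show ?thesis unfolding rec by (simp add: algebra_simps)
      qed
      ultimately show "(F has_field_derivative - ?h u) (at u)" by simp
    next
      show "continuous_on {0<..} (\<lambda>u. - ?h u)"
        unfolding f0_def f1_def f2_def \<omega>_def e_def by (intro continuous_intros) auto
      show "integrable halfline (\<lambda>u. - ?h u)"
        using int0[OF y] int1[OF y] int2[OF y] by auto
      \<comment> \<open>The bound tends to 0 at both ends, at the origin through u^(m+1) even for m
        = 0, so there are no boundary terms.\<close>
      have F_le: "\<bar>F u\<bar> \<le> u ^ (m + 1) * exp (- (\<delta> * u))" if u: "u > 0" for u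
      proof -
        have "exp (- (\<kappa> / u)) * e 0 y u \<le> 1 * exp (- (\<delta> * u))"
          using u \<kappa> y by (intro mult_mono e_le e_nonneg) auto
        then have "F u \<le> u ^ (m + 1) * exp (- (\<delta> * u))" using u unfolding F_def by (intro mult_left_mono) auto
        moreover have "F u \<ge> 0" using u e_nonneg[OF y] by (auto simp: F_def)
        ultimately show ?thesis by simp
      qed
      have "((\<lambda>u. u ^ (m + 1) * exp (- (\<delta> * u))) \<longlongrightarrow> 0 ^ (m + 1) * exp (- (\<delta> * 0))) (at_right 0)"
        by (intro tendsto_intros)
      then show "(F \<longlongrightarrow> 0) (at_right 0)"
        by (rule Lim_null_comparison[rotated, OF tendsto_eq_rhs])
           (auto simp: eventually_at_filter intro!: always_eventually F_le[simplified])
      have "((\<lambda>u. (\<delta> * u) ^ (m + 1) / exp (\<delta> * u)) \<longlongrightarrow> 0) at_top"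
        by (rule filterlim_compose[OF tendsto_power_div_exp_0])
           (use \<delta> in \<open>auto intro!: filterlim_tendsto_pos_mult_at_top[OF tendsto_const] filterlim_ident\<close>)
      from tendsto_mult_right_zero[OF this, of "1 / \<delta> ^ (m + 1)"]
      have "((\<lambda>u. 1 / \<delta> ^ (m + 1) * ((\<delta> * u) ^ (m + 1) / exp (\<delta> * u))) \<longlongrightarrow> 0) at_top" .
      also have "(\<lambda>u. 1 / \<delta> ^ (m + 1) * ((\<delta> * u) ^ (m + 1) / exp (\<delta> * u))) = (\<lambda>u. u ^ (m + 1) * exp (- (\<delta> * u)))"
        using \<delta> by (simp add: power_mult_distrib exp_minus field_simps fun_eq_iff)
      finally have "((\<lambda>u. u ^ (m + 1) * exp (- (\<delta> * u))) \<longlongrightarrow> 0) at_top" .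
      then show "(F \<longlongrightarrow> 0) at_top"
        by (rule Lim_null_comparison[rotated]) (auto intro!: eventually_mono[OF eventually_gt_at_top[of 0]] F_le[simplified])
    qed
    moreover have "(\<integral>u. - ?h u \<partial>halfline) = - (y * \<Phi>2 y + (real m + 1) * \<Phi>1 y - \<kappa> * \<Phi>0 y)"
      unfolding \<Phi>0_def \<Phi>1_def \<Phi>2_def using int0[OF y] int1[OF y] int2[OF y] by simp
    ultimately show ?thesis by simp
  qed
  define g0 where "g0 = (\<lambda>y. bclifford m (\<kappa> * y))"
  define g1 where "g1 = (\<lambda>y. \<kappa> * bclifford (Suc m) (\<kappa> * y))"
  define g2 where "g2 = (\<lambda>y. \<kappa> * (\<kappa> * bclifford (Suc (Suc m)) (\<kappa> * y)))"
  have g0_deriv: "(g0 has_field_derivative g1 y) (at y within S)" for y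
    unfolding g0_def g1_def by (auto intro!: derivative_eq_intros)
  have g1_deriv: "(g1 has_field_derivative g2 y) (at y within S)" for y
    unfolding g1_def g2_def by (auto intro!: derivative_eq_intros)
  have g_ode: "y * g2 y + (real m + 1) * g1 y = \<kappa> * g0 y" for y
    unfolding g0_def g1_def g2_def bclifford_recurrence[of "\<kappa> * y" m, symmetric] by (simp add: algebra_simps)
  \<comment> \<open>The Wronskian of the two solutions; by Abel's identity y^(m+1)
    \<open>w y\<close> is constant.\<close>
  define w where "w = (\<lambda>y. \<Phi>1 y * g0 y - \<Phi>0 y * g1 y)"
  have "((\<lambda>y. y ^ (m + 1) * w y) has_field_derivative 0) (at y within S)" if y: "y \<in> S" for y
  proof -
    have pow_deriv: "((\<lambda>y. y ^ (m + 1)) has_field_derivative (real m + 1) * y ^ m) (at y within S)"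
      using DERIV_pow[of "m + 1" y S] by (simp add: add.commute)
    have w_deriv: "(w has_field_derivative \<Phi>2 y * g0 y - \<Phi>0 y * g2 y) (at y within S)"
      unfolding w_def
      by (auto intro!: derivative_eq_intros \<Phi>0_deriv \<Phi>1_deriv g0_deriv g1_deriv y simp: algebra_simps)
    have "((\<lambda>y. y ^ (m + 1) * w y) has_field_derivative
        (real m + 1) * y ^ m * w y + y ^ (m + 1) * (\<Phi>2 y * g0 y - \<Phi>0 y * g2 y)) (at y within S)"
      by (rule DERIV_cong[OF DERIV_mult[OF pow_deriv w_deriv]]) (simp add: mult_ac)
    also have "(real m + 1) * y ^ m * w y + y ^ (m + 1) * (\<Phi>2 y * g0 y - \<Phi>0 y * g2 y) =
        y ^ m * (g0 y * (y * \<Phi>2 y + (real m + 1) * \<Phi>1 y) - \<Phi>0 y * (y * g2 y + (real m + 1) * g1 y))"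
      by (simp add: w_def algebra_simps)
    also have "\<dots> = 0" unfolding ode[OF y] g_ode by simp
    finally show ?thesis .
  qed
  from has_field_derivative_zero_constant[OF S(1) this]
  obtain c where c: "\<And>y. y \<in> S \<Longrightarrow> y ^ (m + 1) * w y = c" by blast
  \<comment> \<open>For nonzero y the constant equals its value at 0, which is 0. At y = 0 this says
    nothing, but there the equation degenerates to (m+1) y' = \<kappa> y for both solutions, which
    forces \<open>w 0 = 0\<close>.\<close>
  have w0: "w y = 0" if y: "y \<in> S" for y
  proof (cases "y = 0")
    case True
    have "(real m + 1) * w 0 = g0 0 * ((real m + 1) * \<Phi>1 0) - \<Phi>0 0 * ((real m + 1) * g1 0)"
      by (simp add: w_def algebra_simps)
    also have "\<dots> = 0" using ode[OF S(2)] g_ode[of 0] by simp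
    finally show ?thesis unfolding True by (simp add: add_eq_0_iff)
  next
    case False
    then show ?thesis using c[OF y] c[OF S(2)] by simp
  qed
  have g0_pos: "g0 y > 0" if "y \<in> S" for y
    using that \<kappa> by (auto simp: g0_def S_def intro!: bclifford_pos)
  \<comment> \<open>The numerator in the quotient rule is the Wronskian.\<close>
  have "((\<lambda>y. \<Phi>0 y / g0 y) has_field_derivative 0) (at y within S)" if y: "y \<in> S" for y
    using DERIV_divide[OF \<Phi>0_deriv[OF y] g0_deriv] g0_pos[OF y] w0[OF y] by (simp add: w_def)
  from has_field_derivative_zero_constant[OF S(1) this]
  have "\<Phi>0 x / g0 x = \<Phi>0 0 / g0 0" using S by metis
  \<comment> \<open>The value 1/m! of \<open>bclifford m\<close> at 0 occurs here and in
    \<open>g0 0\<close>, and cancels.\<close>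
  moreover have "\<Phi>0 0 = (\<integral>u. \<omega> u * exp (- (u * b)) \<partial>halfline) / fact m"
    unfolding \<Phi>0_def f0_def e_def by simp
  ultimately have "\<Phi>0 x = g0 x * (\<integral>u. \<omega> u * exp (- (u * b)) \<partial>halfline)"
    using g0_pos[OF S(3)] by (simp add: g0_def field_simps)
  then show ?thesis by (simp add: \<Phi>0_def f0_def g0_def \<omega>_def e_def)
qed

section \<open>The integral that yields the K_m factor\<close>

lemma integral_halfline_eq_integral:
  fixes f :: "real \<Rightarrow> real"
  assumes "integrable halfline f"
  shows "f integrable_on {0<..}" "integral {0<..} f = (\<integral>u. f u \<partial>halfline)"
proof -
  have "set_integrable lborel {0<..} f"
    using assms unfolding set_integrable_def by (subst (asm) integrable_restrict_space) auto
  from set_borel_integral_eq_integral[OF this]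
  show "f integrable_on {0<..}" "integral {0<..} f = (\<integral>u. f u \<partial>halfline)"
    by (auto simp: set_lebesgue_integral_def integral_restrict_space)
qed

text \<open>Substituting u = c exp t makes the exponent -k M cosh t on the whole line, with weight
  exp(m t); folding t onto -t gives twice the integral that defines \<open>besselK\<close>.\<close>

lemma besselK_integral:
  assumes k: "k > 0" and M: "M > 0"
  shows "(\<integral>u. u ^ m * (exp (- (k\<^sup>2 / 4 / u)) / u) * exp (- (u * M\<^sup>2)) \<partial>halfline) = 2 * (k / (2 * M)) ^ m * besselK m (k * M)"
proof -
  \<comment> \<open>The point where k^2/(4u) and u M^2 balance, both being kM/2; this makes the
    exponent even in t.\<close>
  define c where "c = k / (2 * M)"
  have c: "c > 0" using k M by (simp add: c_def)
  define \<phi> where "\<phi> = (\<lambda>u. u ^ m * (exp (- (k\<^sup>2 / 4 / u)) / u) * exp (- (u * M\<^sup>2)))"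
  define h where "h = (\<lambda>t. exp (real m * t) * exp (- (k * M) * cosh t))"
  have int_\<phi>: "integrable halfline \<phi>"
  proof (rule Bochner_Integration.integrable_bound)
    show "integrable halfline (\<lambda>u. 1 / (k\<^sup>2 / 4) * (u ^ m * exp (- (M\<^sup>2 * u))))"
      using has_bochner_integral_power_exp[of "M\<^sup>2" m] M
      by (intro integrable_mult_right) (auto simp: has_bochner_integral_iff)
    show "AE u in halfline. norm (\<phi> u) \<le> norm (1 / (k\<^sup>2 / 4) * (u ^ m * exp (- (M\<^sup>2 * u))))"
    proof (rule AE_I2)
      fix u assume "u \<in> space halfline"
      then have u: "u > 0" by (simp add: space_restrict_space)
      have "\<phi> u \<le> u ^ m * (1 / (k\<^sup>2 / 4)) * exp (- (u * M\<^sup>2))"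
        unfolding \<phi>_def using u k by (intro mult_right_mono mult_left_mono exp_neg_divide_le) auto
      moreover have "\<phi> u \<ge> 0" using u by (simp add: \<phi>_def)
      ultimately show "norm (\<phi> u) \<le> norm (1 / (k\<^sup>2 / 4) * (u ^ m * exp (- (M\<^sup>2 * u))))"
        using u by (simp add: mult_ac)
    qed
  qed (simp add: \<phi>_def)
  note \<phi> = integral_halfline_eq_integral[OF int_\<phi>]
  have "\<phi> absolutely_integrable_on {0<..}"
    by (rule nonnegative_absolutely_integrable_1[OF \<phi>(1)]) (auto simp: \<phi>_def)
  moreover have img: "range (\<lambda>t. c * exp t) = {0<..}"
  proof -
    have "u \<in> range (\<lambda>t. c * exp t)" if "u > 0" for u
      using that c by (intro image_eqI[of _ _ "ln (u / c)"]) auto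
    then show ?thesis using c by auto
  qed
  moreover have "((\<lambda>t. c * exp t) has_field_derivative c * exp t) (at t within UNIV)" for t
    by (auto intro!: derivative_eq_intros)
  ultimately have "(\<lambda>t. \<bar>c * exp t\<bar> * \<phi> (c * exp t)) absolutely_integrable_on UNIV \<and>
      integral UNIV (\<lambda>t. \<bar>c * exp t\<bar> * \<phi> (c * exp t)) = integral {0<..} \<phi>"
    using c has_absolute_integral_change_of_variables_1'[of UNIV "\<lambda>t. c * exp t" "\<lambda>t. c * exp t" \<phi> "integral {0<..} \<phi>"]
    by (simp add: inj_on_def)
  moreover have "\<bar>c * exp t\<bar> * \<phi> (c * exp t) = c ^ m * h t" for t
  proof -
    have "k\<^sup>2 / 4 / (c * exp t) + c * exp t * M\<^sup>2 = k * M * cosh t"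
      using k M by (simp add: c_def cosh_def exp_minus field_simps power2_eq_square)
    then have "exp (- (k\<^sup>2 / 4 / (c * exp t))) * exp (- (c * exp t * M\<^sup>2)) = exp (- (k * M) * cosh t)"
      by (simp add: mult_exp_exp)
    moreover have "(c * exp t) ^ m = c ^ m * exp (real m * t)"
      by (simp add: power_mult_distrib exp_of_nat_mult)
    ultimately show ?thesis
      using c unfolding \<phi>_def h_def by (simp add: abs_mult mult_ac)
  qed
  ultimately have h_UNIV: "(\<lambda>t. c ^ m * h t) absolutely_integrable_on UNIV" "integral UNIV (\<lambda>t. c ^ m * h t) = integral {0<..} \<phi>"
    by auto
  have h_int: "h absolutely_integrable_on UNIV"
    using set_integrable_mult_right[of "1 / c ^ m" lebesgue UNIV "\<lambda>t. c ^ m * h t"] h_UNIV(1) c by simp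
  have h_pos: "h absolutely_integrable_on {0..}" and h_neg: "h absolutely_integrable_on {..0}"
    using h_int by (auto intro: set_integrable_subset)
  have "integral UNIV h = integral {..0} h + integral {0..} h"
  proof -
    have "negligible ({..0} \<inter> {0::real..})"
      by (rule negligible_subset[of "{0}"]) auto
    moreover have "{..0} \<union> {0::real..} = UNIV" by auto
    ultimately show ?thesis
      using integral_Un[of h "{..0}" "{0..}"] h_pos h_neg set_lebesgue_integral_eq_integral(1) by auto
  qed
  moreover have "(\<lambda>t. h (- t)) absolutely_integrable_on {0..} \<and> integral {0..} (\<lambda>t. h (- t)) = integral {..0} h"
  proof -
    have "uminus ` {0::real..} = {..0}" by auto
    moreover have "(uminus has_field_derivative - 1) (at t within {0..})" for t :: real
      by (auto intro!: derivative_eq_intros)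
    ultimately show ?thesis
      using h_neg has_absolute_integral_change_of_variables_1'[of "{0..}" uminus "\<lambda>_. -1" h "integral {..0} h"]
      by simp
  qed
  moreover have "integral {0..} (\<lambda>t. h (- t)) + integral {0..} h = 2 * besselK m (k * M)"
  proof -
    have "integral {0..} (\<lambda>t. h (- t)) + integral {0..} h = integral {0..} (\<lambda>t. h (- t) + h t)"
      using calculation(2) h_pos set_lebesgue_integral_eq_integral(1)
      by (intro Henstock_Kurzweil_Integration.integral_add[symmetric]) auto
    also have "(\<lambda>t. h (- t) + h t) = (\<lambda>t. 2 * (exp (- (k * M) * cosh t) * cosh (real m * t)))"
      by (auto simp: h_def cosh_def field_simps fun_eq_iff)
    finally show ?thesis by (simp add: besselK_def)
  qed
  ultimately have "integral UNIV h = 2 * besselK m (k * M)" by linarith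
  then show ?thesis using h_UNIV(2) \<phi>(2) unfolding \<phi>_def[symmetric] c_def[symmetric] by simp
qed

text \<open>The integrand sees the radii only through their product and the sum of their squares, so
  they may be ordered. Being distinct, they satisfy the strict inequality of
  \<open>integral_exp_bclifford\<close>.\<close>

lemma integral_exp_besselI:
  assumes \<mu>: "\<mu> > 0" and mu1: "mu1 > 0" and neq: "\<mu> \<noteq> mu1" and k: "k > 0"
  shows "(\<integral>u. exp (- (k\<^sup>2 / 4 / u)) / u * exp (- (u * (\<mu>\<^sup>2 + mu1\<^sup>2))) * besselI m (2 * \<mu> * mu1 * u) \<partial>halfline) =
    2 * besselI m (k * min \<mu> mu1) * besselK m (k * max \<mu> mu1)"
proof -
  define n M where "n = min \<mu> mu1" and "M = max \<mu> mu1"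
  have nM: "n > 0" "M > 0" "n < M" and prod: "\<mu> * mu1 = n * M" and add: "\<mu>\<^sup>2 + mu1\<^sup>2 = n\<^sup>2 + M\<^sup>2"
    using \<mu> mu1 neq by (auto simp: n_def M_def min_def max_def)
  have integrand_eq: "exp (- (k\<^sup>2 / 4 / u)) / u * exp (- (u * (\<mu>\<^sup>2 + mu1\<^sup>2))) * besselI m (2 * \<mu> * mu1 * u) =
      (n * M) ^ m * (u ^ m * (exp (- (k\<^sup>2 / 4 / u)) / u) * (exp (- (u * (n\<^sup>2 + M\<^sup>2))) * bclifford m (u\<^sup>2 * n\<^sup>2 * M\<^sup>2)))" for u
  proof -
    have "besselI m (2 * \<mu> * mu1 * u) = ((n * M) * u) ^ m * bclifford m (u\<^sup>2 * n\<^sup>2 * M\<^sup>2)"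
    proof -
      have eq: "2 * \<mu> * mu1 * u = 2 * (n * M * u)" unfolding prod[symmetric] by simp
      show ?thesis unfolding eq by (simp add: besselI_eq_bclifford power_mult_distrib mult_ac)
    qed
    then show ?thesis unfolding add by (simp add: power_mult_distrib mult_ac)
  qed
  have side: "k\<^sup>2 / 4 > 0" "0 \<le> n\<^sup>2" "n\<^sup>2 < M\<^sup>2"
    using k nM by (auto intro!: power_strict_mono)
  have "(\<integral>u. exp (- (k\<^sup>2 / 4 / u)) / u * exp (- (u * (\<mu>\<^sup>2 + mu1\<^sup>2))) * besselI m (2 * \<mu> * mu1 * u) \<partial>halfline) =
      (n * M) ^ m * (bclifford m (k\<^sup>2 / 4 * n\<^sup>2) * (2 * (k / (2 * M)) ^ m * besselK m (k * M)))"
    unfolding integrand_eq integral_mult_right_zero integral_exp_bclifford[OF side] besselK_integral[OF k nM(2)] ..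
  also have "\<dots> = 2 * ((n * M) ^ m * (k / (2 * M)) ^ m * bclifford m (k\<^sup>2 / 4 * n\<^sup>2)) * besselK m (k * M)"
    by simp
  also have "(n * M) ^ m * (k / (2 * M)) ^ m = (k * n / 2) ^ m"
    using nM unfolding power_mult_distrib[symmetric] by (simp add: mult.commute)
  also have "(k * n / 2) ^ m * bclifford m (k\<^sup>2 / 4 * n\<^sup>2) = besselI m (k * n)"
    by (simp add: besselI_eq_bclifford power_mult_distrib)
  finally show ?thesis by (simp add: n_def M_def)
qed

section \<open>Decay of the Bessel function\<close>

lemma has_field_derivative_besselJ:
  assumes "x > 0"
  shows "(besselJ m has_field_derivative real m / x * besselJ m x - besselJ (Suc m) x) (at x)"
proof -
  have "((\<lambda>x. (x / 2) ^ m) has_field_derivative real m / x * (x / 2) ^ m) (at x)"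
  proof (rule DERIV_cong[OF DERIV_power[of _ "1/2"]])
    show "((\<lambda>x. x / 2) has_field_derivative 1/2) (at x)"
      by (auto intro!: derivative_eq_intros)
    show "real m * (1/2 * (x / 2) ^ (m - Suc 0)) = real m / x * (x / 2) ^ m"
      using assms by (cases m) auto
  qed
  moreover have "((\<lambda>x. bclifford m (- (x\<^sup>2 / 4))) has_field_derivative bclifford (Suc m) (- (x\<^sup>2 / 4)) * (- (x / 2))) (at x)"
    by (auto intro!: derivative_eq_intros)
  ultimately have "((\<lambda>x. (x / 2) ^ m * bclifford m (- (x\<^sup>2 / 4))) has_field_derivative
      real m / x * (x / 2) ^ m * bclifford m (- (x\<^sup>2 / 4)) + bclifford (Suc m) (- (x\<^sup>2 / 4)) * (- (x / 2)) * (x / 2) ^ m) (at x)"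
    by (rule DERIV_mult)
  then show ?thesis
    unfolding besselJ_eq_bclifford[abs_def] by (simp add: mult_ac)
qed

lemma besselJ_recurrence:
  assumes "x > 0"
  shows "besselJ m x + besselJ (Suc (Suc m)) x = 2 * (real m + 1) / x * besselJ (Suc m) x"
  unfolding besselJ_eq_bclifford bclifford_recurrence[of "- (x\<^sup>2 / 4)" m, symmetric]
  using assms by (simp add: field_simps power2_eq_square)

text \<open>Eliminating J_(m+2) closes the first-order system for J_m and J_(m+1) on which the
  energy estimate rests.\<close>

lemma has_field_derivative_besselJ_Suc:
  assumes "x > 0"
  shows "(besselJ (Suc m) has_field_derivative besselJ m x - (real m + 1) / x * besselJ (Suc m) x) (at x)"
proof -
  have "besselJ (Suc (Suc m)) x = 2 * (real m + 1) / x * besselJ (Suc m) x - besselJ m x"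
    using besselJ_recurrence[OF assms, of m] by linarith
  then have "real (Suc m) / x * besselJ (Suc m) x - besselJ (Suc (Suc m)) x =
      besselJ m x - (real m + 1) / x * besselJ (Suc m) x"
    by (simp add: algebra_simps add_divide_distrib)
  then show ?thesis using has_field_derivative_besselJ[OF assms, of "Suc m"] by simp
qed

lemma continuous_on_besselJ [continuous_intros]:
  "continuous_on S f \<Longrightarrow> continuous_on S (\<lambda>x. besselJ m (f x))"
  unfolding besselJ_eq_bclifford by (intro continuous_intros) auto

text \<open>An energy argument controls x (J_m^2 + J_(m+1)^2) for x >= 2m+1; compactness covers the
  rest.\<close>

lemma besselJ_decay: "\<exists>C\<ge>0. \<forall>x>0. \<bar>besselJ m x\<bar> * sqrt x \<le> C"
proof -
  \<comment> \<open>The derivative of x (J^2 + J1^2) is (2m+1)(J^2 - J1^2), which the cross term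
    with this coefficient cancels. From x = r on, the cross term takes at most half of the main
    term.\<close>
  define r where "r = 2 * real m + 1"
  have r: "r > 0" by (simp add: r_def)
  define J where "J = besselJ m"
  define J1 where "J1 = besselJ (Suc m)"
  \<comment> \<open>The cross term makes the derivative of the energy \<open>O(energy / x\<^sup>2)\<close>, which is integrable at infinity.\<close>
  define E where "E = (\<lambda>x. x * ((J x)\<^sup>2 + (J1 x)\<^sup>2) - r * (J x * J1 x))"
  \<comment> \<open>The integrating factor for E' <= (r/x^2) E; it is at least 1, so bounding
    \<open>G\<close> bounds \<open>E\<close>.\<close>
  define G where "G = (\<lambda>x. E x * exp (r / x))"
  have E_deriv: "(E has_field_derivative r * (J x * J1 x) / x) (at x)" if x: "x > 0" for x
  proof -
    note d = has_field_derivative_besselJ[OF x, of m, folded J_def J1_def]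
      has_field_derivative_besselJ_Suc[OF x, of m, folded J_def J1_def]
    have "(E has_field_derivative
       ((J x)\<^sup>2 + (J1 x)\<^sup>2) + x * (2 * J x * (real m / x * J x - J1 x) + 2 * J1 x * (J x - (real m + 1) / x * J1 x))
         - r * ((real m / x * J x - J1 x) * J1 x + J x * (J x - (real m + 1) / x * J1 x))) (at x)"
      unfolding E_def using x by (auto intro!: derivative_eq_intros d simp: algebra_simps)
    also have "((J x)\<^sup>2 + (J1 x)\<^sup>2) + x * (2 * J x * (real m / x * J x - J1 x) + 2 * J1 x * (J x - (real m + 1) / x * J1 x))
         - r * ((real m / x * J x - J1 x) * J1 x + J x * (J x - (real m + 1) / x * J1 x)) = r * (J x * J1 x) / x"
      using x by (simp add: r_def field_simps power2_eq_square)
    finally show ?thesis .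
  qed
  have cross: "\<bar>J x * J1 x\<bar> \<le> ((J x)\<^sup>2 + (J1 x)\<^sup>2) / 2" for x
  proof -
    have "0 \<le> (\<bar>J x\<bar> - \<bar>J1 x\<bar>)\<^sup>2" by simp
    then show ?thesis by (simp add: power2_diff abs_mult)
  qed
  have E_ge: "E x \<ge> x / 2 * ((J x)\<^sup>2 + (J1 x)\<^sup>2)" if x: "x \<ge> r" for x
  proof -
    have "r * (J x * J1 x) \<le> x * (((J x)\<^sup>2 + (J1 x)\<^sup>2) / 2)"
      using r x cross[of x] by (intro mult_mono' order_trans[OF mult_left_mono[of _ "\<bar>J x * J1 x\<bar>" r] mult_mono]) auto
    then show ?thesis by (simp add: E_def field_simps)
  qed
  have G_le: "G x \<le> G r" if x: "x \<ge> r" for x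
  proof (rule DERIV_nonpos_imp_nonincreasing[OF x])
    fix y assume y: "r \<le> y" "y \<le> x"
    then have y0: "y > 0" using r by simp
    have "(G has_field_derivative (r * (J y * J1 y) / y - r / y\<^sup>2 * E y) * exp (r / y)) (at y)"
      unfolding G_def using y0
      by (auto intro!: derivative_eq_intros E_deriv simp: field_simps power2_eq_square)
    moreover have "r * (J y * J1 y) / y \<le> r / y\<^sup>2 * E y"
    proof -
      have "J y * J1 y \<le> ((J y)\<^sup>2 + (J1 y)\<^sup>2) / 2" using cross[of y] by linarith
      then have "y * (J y * J1 y) \<le> y * (((J y)\<^sup>2 + (J1 y)\<^sup>2) / 2)" using y0 by (intro mult_left_mono) auto
      also have "\<dots> \<le> E y" using E_ge[OF y(1)] by simp
      finally have "r / y\<^sup>2 * (y * (J y * J1 y)) \<le> r / y\<^sup>2 * E y" using r by (intro mult_left_mono) auto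
      then show ?thesis using y0 by (simp add: power2_eq_square)
    qed
    ultimately show "\<exists>d. (G has_field_derivative d) (at y) \<and> d \<le> 0"
      by (intro exI conjI) (auto intro!: mult_nonpos_nonneg)
  qed
  have large: "\<bar>J x\<bar> * sqrt x \<le> sqrt (2 * G r)" if x: "x \<ge> r" for x
  proof (rule real_le_rsqrt)
    have x0: "x > 0" using x r by simp
    have "0 \<le> x / 2 * ((J x)\<^sup>2 + (J1 x)\<^sup>2)" using x0 by simp
    then have E0: "0 \<le> E x" using E_ge[OF x] by linarith
    have "x / 2 * (J x)\<^sup>2 \<le> x / 2 * ((J x)\<^sup>2 + (J1 x)\<^sup>2)" using x0 by (intro mult_left_mono) auto
    also have "\<dots> \<le> E x * 1" using E_ge[OF x] by simp
    also have "\<dots> \<le> G x" unfolding G_def using E0 r x0 by (intro mult_left_mono) auto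
    also have "\<dots> \<le> G r" by (rule G_le[OF x])
    finally show "(\<bar>J x\<bar> * sqrt x)\<^sup>2 \<le> 2 * G r" using x0 by (simp add: power_mult_distrib mult_ac)
  qed
  have "continuous_on {0..r} (\<lambda>x. \<bar>J x\<bar> * sqrt x)"
    unfolding J_def by (intro continuous_intros)
  then have "bounded ((\<lambda>x. \<bar>J x\<bar> * sqrt x) ` {0..r})"
    by (intro compact_imp_bounded compact_continuous_image) auto
  then obtain B where B: "\<And>x. x \<in> {0..r} \<Longrightarrow> \<bar>J x\<bar> * sqrt x \<le> B"
    unfolding bounded_iff by (metis (no_types, lifting) abs_le_D1 imageI real_norm_def)
  have "\<bar>J x\<bar> * sqrt x \<le> max 0 (max B (sqrt (2 * G r)))" if "x > 0" for x
    using large[of x] B[of x] that by (cases "x \<le> r") auto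
  then show ?thesis unfolding J_def by (intro exI[of _ "max 0 (max B (sqrt (2 * G r)))"]) auto
qed

section \<open>The integral over the product of Legendre and Bessel functions\<close>

lemma chi_eq:
  assumes "lam > 0" "lam1 > 0" "\<mu> > 0" "mu1 > 0"
  shows "chi lam lam1 \<mu> mu1 =
    ((lam\<^sup>2 + lam1\<^sup>2 + \<mu>\<^sup>2 + mu1\<^sup>2)\<^sup>2 - (2 * \<mu> * mu1)\<^sup>2 - (2 * lam1 * lam)\<^sup>2) / (2 * (2 * \<mu> * mu1) * (2 * lam1 * lam))"
proof -
  have "4 * lam\<^sup>2 * \<mu>\<^sup>2 + 4 * lam1\<^sup>2 * mu1\<^sup>2 + (lam\<^sup>2 - lam1\<^sup>2 + mu1\<^sup>2 - \<mu>\<^sup>2)\<^sup>2 =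
      (lam\<^sup>2 + lam1\<^sup>2 + \<mu>\<^sup>2 + mu1\<^sup>2)\<^sup>2 - (2 * \<mu> * mu1)\<^sup>2 - (2 * lam1 * lam)\<^sup>2"
    by (simp add: power2_eq_square algebra_simps)
  moreover have "8 * lam * lam1 * \<mu> * mu1 = 2 * (2 * \<mu> * mu1) * (2 * lam1 * lam)" by simp
  ultimately show ?thesis unfolding chi_def by (simp only:)
qed

lemma integrable_halflineI:
  fixes f :: "real \<Rightarrow> real"
  shows "integrable lborel f \<Longrightarrow> integrable halfline f"
  using integrable_mult_indicator[of "{0<..}" lborel f] by (subst integrable_restrict_space) auto

text \<open>The majorant of the double integral once u is integrated out: bounded on compact sets,
  of order x^(-3/2) at infinity.\<close>

lemma integrable_sqrt_over_quadratic:
  fixes c d :: real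
  assumes c: "c > 0" and d: "d > 0"
  shows "integrable halfline (\<lambda>x. sqrt x / ((x - c)\<^sup>2 + d))"
proof (rule Bochner_Integration.integrable_bound)
  \<comment> \<open>Beyond 2c+1 one has x - c >= x/2, so the denominator is at least x^2/4.\<close>
  define L where "L = 2 * c + 1"
  let ?g = "\<lambda>x. sqrt L / d * indicator {0..L} x + 4 * (x powr (- (3/2)) * indicator {L..} x)"
  have L: "L > 0" using c by (simp add: L_def)
  have "(\<integral>\<^sup>+x. ennreal (x powr (- (3/2))) * indicator {L..} x \<partial>lborel) = ennreal (0 - (- 2 * L powr (- (1/2))))"
  proof (rule nn_integral_FTC_atLeast)
    show "((\<lambda>x. - 2 * x powr (- (1/2))) has_field_derivative x powr (- (3/2))) (at x)" if "L \<le> x" for x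
      using that L by (auto intro!: derivative_eq_intros)
    have "((\<lambda>x. x powr (- (1/2 :: real))) \<longlongrightarrow> 0) at_top"
      by (rule tendsto_neg_powr) (auto intro: filterlim_ident)
    from tendsto_mult_right_zero[OF this, of "- 2"] show "((\<lambda>x. - 2 * x powr (- (1/2 :: real))) \<longlongrightarrow> 0) at_top" .
  qed auto
  then have "integrable lborel (\<lambda>x. x powr (- (3/2)) * indicator {L..} x)"
    by (intro integrableI_nonneg) (auto simp: ennreal_mult'' ennreal_indicator ennreal_mult_less_top)
  then have "integrable lborel ?g"
    by (intro Bochner_Integration.integrable_add integrable_mult_right integrable_real_indicator)
       (use L in auto)
  then show "integrable halfline ?g" by (rule integrable_halflineI)
  show "AE x in halfline. norm (sqrt x / ((x - c)\<^sup>2 + d)) \<le> norm (?g x)"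
  proof (rule AE_I2)
    fix x assume "x \<in> space halfline"
    then have x: "x > 0" by (simp add: space_restrict_space)
    have pos: "(x - c)\<^sup>2 + d > 0" using d by (simp add: add_nonneg_pos)
    have "sqrt x / ((x - c)\<^sup>2 + d) \<le> ?g x"
    proof (cases "x \<le> L")
      case True
      have "sqrt x / ((x - c)\<^sup>2 + d) \<le> sqrt L / d"
        using True x d L by (intro frac_le) auto
      also have "\<dots> \<le> ?g x" using True x by auto
      finally show ?thesis .
    next
      case False
      then have "x / 2 \<le> x - c" by (simp add: L_def)
      then have "(x / 2)\<^sup>2 \<le> (x - c)\<^sup>2" using x by (intro power_mono) auto
      then have "sqrt x / ((x - c)\<^sup>2 + d) \<le> sqrt x / (x\<^sup>2 / 4)"
        using x d by (intro divide_left_mono) (auto simp: power_divide intro!: mult_pos_pos add_nonneg_pos)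
      also have "\<dots> = 4 * x powr (- (3/2))"
      proof -
        have "x powr (- (3/2)) = x powr (1/2 - 2)" by simp
        also have "\<dots> = sqrt x / x\<^sup>2" using x by (simp only: powr_diff powr_half_sqrt powr_numeral less_imp_le)
        finally show ?thesis by simp
      qed
      finally show ?thesis using False x by simp
    qed
    moreover have "0 \<le> sqrt x / ((x - c)\<^sup>2 + d)" using pos x by simp
    ultimately show "norm (sqrt x / ((x - c)\<^sup>2 + d)) \<le> norm (?g x)" unfolding real_norm_def by linarith
  qed
qed measurable

text \<open>The difference is (lam - lam1)^2 + (\<mu> - mu1)^2, positive even at lam = lam1. This is
  the Laplace condition p > a + b.\<close>

lemma sum_of_squares_gap:
  fixes lam lam1 \<mu> mu1 :: real
  assumes "\<mu> \<noteq> mu1"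
  shows "lam\<^sup>2 + lam1\<^sup>2 + \<mu>\<^sup>2 + mu1\<^sup>2 > 2 * \<mu> * mu1 + 2 * lam1 * lam"
proof -
  have "(lam - lam1)\<^sup>2 + (\<mu> - mu1)\<^sup>2 > 0" using assms by (simp add: add_nonneg_pos)
  then show ?thesis by (simp add: power2_diff algebra_simps)
qed

text \<open>By \<open>chi_eq\<close> the claim is p^2 > (a + b)^2.\<close>

lemma chi_gt_1:
  assumes "lam > 0" "lam1 > 0" "\<mu> > 0" "mu1 > 0" "\<mu> \<noteq> mu1"
  shows "chi lam lam1 \<mu> mu1 > 1"
proof -
  define p a b where "p = lam\<^sup>2 + lam1\<^sup>2 + \<mu>\<^sup>2 + mu1\<^sup>2" and "a = 2 * \<mu> * mu1" and "b = 2 * lam1 * lam"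
  have ab: "a > 0" "b > 0" using assms by (auto simp: a_def b_def)
  have "p > a + b" unfolding p_def a_def b_def using sum_of_squares_gap[OF assms(5)] .
  then have "p\<^sup>2 > (a + b)\<^sup>2" using ab by (intro power_strict_mono) auto
  then have "(p\<^sup>2 - a\<^sup>2 - b\<^sup>2) / (2 * a * b) > 1" using ab by (simp add: field_simps power2_eq_square)
  then show ?thesis
    unfolding chi_eq[OF assms(1-4)] p_def[symmetric] a_def[symmetric] b_def[symmetric] .
qed

text \<open>Fubini for \<open>h\<close>: the u-integral first gives the Legendre function; the
  l-integral first is Weber's, after which \<open>integral_exp_besselI\<close> finishes.\<close>

lemma integral_legendreQ_besselJ:
  assumes lam1: "lam1 > 0" and \<mu>: "\<mu> > 0" and mu1: "mu1 > 0" and neq: "\<mu> \<noteq> mu1" and k: "k > 0"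
  shows "has_bochner_integral halfline
      (\<lambda>lam. legendreQ (real m - 1/2) (chi lam lam1 \<mu> mu1) * besselJ m (k * lam) * sqrt lam)
      (2 * pi * sqrt (lam1 * \<mu> * mu1) * besselJ m (k * lam1) * besselI m (k * min \<mu> mu1) * besselK m (k * max \<mu> mu1))"
proof -
  let ?T = "\<lambda>l. legendreQ (real m - 1/2) (chi l lam1 \<mu> mu1) * besselJ m (k * l) * sqrt l"
  define p where "p = (\<lambda>l. l\<^sup>2 + lam1\<^sup>2 + \<mu>\<^sup>2 + mu1\<^sup>2)"
  define a where "a = 2 * \<mu> * mu1"
  \<comment> \<open>The weight is l rather than sqrt l: Weber's integral needs it, and the Laplace
    transform contributes 1/sqrt l.\<close>
  define h where "h = (\<lambda>l u. exp (- (p l * u)) * besselI m (a * u) * besselI m (2 * lam1 * l * u) * (besselJ m (k * l) * l))"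
  define \<delta> where "\<delta> = (\<mu> - mu1)\<^sup>2"
  \<comment> \<open>This is p l - a - 2 lam1 l, the decay rate in u left after bounding both
    modified Bessel functions by exponentials.\<close>
  define q where "q = (\<lambda>l. (l - lam1)\<^sup>2 + \<delta>)"
  have \<delta>: "\<delta> > 0" using neq by (simp add: \<delta>_def)
  have q: "q l > 0" for l using \<delta> by (simp add: q_def add_nonneg_pos)
  have a: "a > 0" using \<mu> mu1 by (simp add: a_def)
  have pos: "x > 0" if "x \<in> space halfline" for x using that by (simp add: space_restrict_space)
  interpret H: sigma_finite_measure halfline by (rule sigma_finite_halfline)
  interpret P: pair_sigma_finite halfline halfline ..
  obtain C where C: "C \<ge> 0" "\<And>x. x > 0 \<Longrightarrow> \<bar>besselJ m x\<bar> * sqrt x \<le> C"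
    using besselJ_decay by blast
  have J_le: "\<bar>besselJ m (k * l)\<bar> * l \<le> C / sqrt k * sqrt l" if l: "l > 0" for l
  proof -
    have "\<bar>besselJ m (k * l)\<bar> * l = (\<bar>besselJ m (k * l)\<bar> * sqrt (k * l)) * (sqrt l / sqrt k)"
      using l k by (simp add: real_sqrt_mult)
    also have "\<dots> \<le> C * (sqrt l / sqrt k)"
      using l k by (intro mult_right_mono C) auto
    finally show ?thesis by simp
  qed
  have h_le: "\<bar>h l u\<bar> \<le> C / sqrt k * sqrt l * exp (- (q l * u))" if l: "l > 0" and u: "u > 0" for l u
  proof -
    have "\<bar>h l u\<bar> = exp (- (p l * u)) * besselI m (a * u) * besselI m (2 * lam1 * l * u) * (\<bar>besselJ m (k * l)\<bar> * l)"
      using l u a lam1 by (simp add: h_def abs_mult besselI_nonneg)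
    also have "\<dots> \<le> exp (- (p l * u)) * exp (a * u) * exp (2 * lam1 * l * u) * (C / sqrt k * sqrt l)"
      using l u a lam1 by (intro mult_mono besselI_le_exp besselI_nonneg mult_nonneg_nonneg J_le) auto
    also have "exp (- (p l * u)) * exp (a * u) * exp (2 * lam1 * l * u) = exp (- (q l * u))"
      by (simp add: mult_exp_exp p_def a_def q_def \<delta>_def power2_eq_square algebra_simps)
    finally show ?thesis by (simp add: mult_ac)
  qed
  have [measurable]: "fst \<in> borel_measurable (halfline \<Otimes>\<^sub>M halfline)" "snd \<in> borel_measurable (halfline \<Otimes>\<^sub>M halfline)"
    by (rule measurable_compose[OF measurable_fst], simp, rule measurable_compose[OF measurable_snd], simp)
  have h_meas: "case_prod h \<in> borel_measurable (halfline \<Otimes>\<^sub>M halfline)"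
    unfolding h_def p_def case_prod_unfold by measurable
  have exp_q: "has_bochner_integral halfline (\<lambda>u. exp (- (q l * u))) (1 / q l)" for l
    using has_bochner_integral_power_exp[OF q[of l], of 0] by simp
  have int_u: "integrable halfline (h l)" if l: "l > 0" for l
  proof (rule Bochner_Integration.integrable_bound)
    show "integrable halfline (\<lambda>u. C / sqrt k * sqrt l * exp (- (q l * u)))"
      using exp_q by (intro integrable_mult_right) (auto simp: has_bochner_integral_iff)
    show "AE u in halfline. norm (h l u) \<le> norm (C / sqrt k * sqrt l * exp (- (q l * u)))"
      by (rule AE_I2, unfold real_norm_def) (rule order_trans[OF h_le[OF l pos] abs_ge_self])
  qed (simp add: h_def)
  have h_int: "integrable (halfline \<Otimes>\<^sub>M halfline) (case_prod h)"
  proof (rule P.Fubini_integrable[OF h_meas])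
    show "AE l in halfline. integrable halfline (\<lambda>u. case_prod h (l, u))"
      using int_u pos by (intro AE_I2) simp
    show "integrable halfline (\<lambda>l. \<integral>u. norm (case_prod h (l, u)) \<partial>halfline)"
    proof (rule Bochner_Integration.integrable_bound)
      show "integrable halfline (\<lambda>l. C / sqrt k * (sqrt l / q l))"
        unfolding q_def by (intro integrable_mult_right integrable_sqrt_over_quadratic lam1 \<delta>)
      show "(\<lambda>l. \<integral>u. norm (case_prod h (l, u)) \<partial>halfline) \<in> borel_measurable halfline"
        using h_meas by (intro H.borel_measurable_lebesgue_integral) (simp add: case_prod_unfold)
      show "AE l in halfline. norm (\<integral>u. norm (case_prod h (l, u)) \<partial>halfline) \<le> norm (C / sqrt k * (sqrt l / q l))"
      proof (rule AE_I2)
        fix l assume "l \<in> space halfline"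
        then have l: "l > 0" by (rule pos)
        have "(\<integral>u. norm (h l u) \<partial>halfline) \<le> (\<integral>u. C / sqrt k * sqrt l * exp (- (q l * u)) \<partial>halfline)"
          using int_u[OF l] exp_q h_le[OF l pos]
          by (intro integral_mono integrable_norm integrable_mult_right) (auto simp: has_bochner_integral_iff)
        also have "\<dots> = C / sqrt k * (sqrt l / q l)"
          using exp_q[of l] by (simp add: has_bochner_integral_iff)
        finally show "norm (\<integral>u. norm (case_prod h (l, u)) \<partial>halfline) \<le> norm (C / sqrt k * (sqrt l / q l))"
          using C(1) l k q[of l] by (simp add: abs_mult)
      qed
    qed
  qed
  \<comment> \<open>With b = 2 lam1 l, the Laplace denominator pi sqrt(ab) is c sqrt l.\<close>
  define c where "c = 2 * pi * sqrt (lam1 * \<mu> * mu1)"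
  have c: "c > 0" using lam1 \<mu> mu1 by (simp add: c_def)
  have inner_u: "(\<integral>u. h l u \<partial>halfline) = ?T l / c" if l: "l > 0" for l
  proof -
    have b: "2 * lam1 * l > 0" using lam1 l by simp
    have gap: "p l > a + 2 * lam1 * l" unfolding p_def a_def by (rule sum_of_squares_gap[OF neq])
    have "(\<integral>u. h l u \<partial>halfline) = (\<integral>u. exp (- (p l * u)) * besselI m (a * u) * besselI m (2 * lam1 * l * u) \<partial>halfline) * (besselJ m (k * l) * l)"
      unfolding h_def by simp
    also have "\<dots> = legendreQ (real m - 1/2) (chi l lam1 \<mu> mu1) / (pi * sqrt (a * (2 * lam1 * l))) * (besselJ m (k * l) * l)"
      unfolding laplace_besselI_besselI[OF a b gap] chi_eq[OF l lam1 \<mu> mu1]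
      unfolding p_def a_def ..
    also have "pi * sqrt (a * (2 * lam1 * l)) = c * sqrt l"
    proof -
      have "a * (2 * lam1 * l) = 2\<^sup>2 * (lam1 * \<mu> * mu1) * l" by (simp add: a_def)
      then show ?thesis by (simp only: real_sqrt_mult c_def) simp
    qed
    also have "legendreQ (real m - 1/2) (chi l lam1 \<mu> mu1) / (c * sqrt l) * (besselJ m (k * l) * l) = ?T l / c"
      using l c by (simp add: field_simps)
    finally show ?thesis .
  qed
  have inner_l: "(\<integral>l. h l u \<partial>halfline) = besselJ m (k * lam1) / 2 *
      (exp (- (k\<^sup>2 / 4 / u)) / u * exp (- (u * (\<mu>\<^sup>2 + mu1\<^sup>2))) * besselI m (2 * \<mu> * mu1 * u))" if u: "u > 0" for u
  proof -
    have "h l u = (exp (- (u * (\<mu>\<^sup>2 + mu1\<^sup>2))) * exp (- (u * lam1\<^sup>2)) * besselI m (a * u)) *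
        (exp (- (u * l\<^sup>2)) * besselI m (2 * u * lam1 * l) * besselJ m (k * l) * l)" for l
    proof -
      have "- (p l * u) = - (u * (\<mu>\<^sup>2 + mu1\<^sup>2)) + - (u * lam1\<^sup>2) + - (u * l\<^sup>2)"
        by (simp add: p_def algebra_simps)
      then show ?thesis unfolding h_def by (simp only: exp_add) (simp add: mult_ac)
    qed
    then have "(\<integral>l. h l u \<partial>halfline) = (exp (- (u * (\<mu>\<^sup>2 + mu1\<^sup>2))) * exp (- (u * lam1\<^sup>2)) * besselI m (a * u)) *
        (exp (u * lam1\<^sup>2) * exp (- (k\<^sup>2 / (4 * u))) * besselJ m (k * lam1) / (2 * u))"
      using weber_integral[OF u lam1 k, of m] by simp
    also have "\<dots> = (exp (- (u * lam1\<^sup>2)) * exp (u * lam1\<^sup>2)) * (besselJ m (k * lam1) / 2 *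
      (exp (- (k\<^sup>2 / (4 * u))) / u * exp (- (u * (\<mu>\<^sup>2 + mu1\<^sup>2))) * besselI m (2 * \<mu> * mu1 * u)))"
      by (simp add: a_def)
    finally show ?thesis by (simp add: mult_exp_exp)
  qed
  have "(\<integral>l. ?T l / c \<partial>halfline) = (\<integral>l. (\<integral>u. h l u \<partial>halfline) \<partial>halfline)"
    using inner_u pos by (intro Bochner_Integration.integral_cong) auto
  also have "\<dots> = (\<integral>u. (\<integral>l. h l u \<partial>halfline) \<partial>halfline)"
    by (rule P.Fubini_integral[OF h_int, symmetric])
  also have "\<dots> = (\<integral>u. besselJ m (k * lam1) / 2 *
      (exp (- (k\<^sup>2 / 4 / u)) / u * exp (- (u * (\<mu>\<^sup>2 + mu1\<^sup>2))) * besselI m (2 * \<mu> * mu1 * u)) \<partial>halfline)"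
    using inner_l pos by (intro Bochner_Integration.integral_cong) auto
  also have "\<dots> = besselJ m (k * lam1) / 2 * (2 * besselI m (k * min \<mu> mu1) * besselK m (k * max \<mu> mu1))"
    unfolding integral_mult_right_zero integral_exp_besselI[OF \<mu> mu1 neq k] ..
  finally have val: "(\<integral>l. ?T l / c \<partial>halfline) = besselJ m (k * lam1) * besselI m (k * min \<mu> mu1) * besselK m (k * max \<mu> mu1)"
    by simp
  have "integrable halfline (\<lambda>l. \<integral>u. h l u \<partial>halfline)" by (rule P.integrable_fst[OF h_int])
  then have "integrable halfline (\<lambda>l. ?T l / c)"
    using inner_u pos by (subst (asm) Bochner_Integration.integrable_cong[OF refl]) auto
  with val have "has_bochner_integral halfline (\<lambda>l. ?T l / c) (besselJ m (k * lam1) * besselI m (k * min \<mu> mu1) * besselK m (k * max \<mu> mu1))"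
    by (simp only: has_bochner_integral_iff simp_thms)
  from has_bochner_integral_mult_right[OF this, of c]
  have "has_bochner_integral halfline (\<lambda>l. c * (?T l / c)) (c * (besselJ m (k * lam1) * besselI m (k * min \<mu> mu1) * besselK m (k * max \<mu> mu1)))"
    by blast
  then show ?thesis using lam1 \<mu> mu1 unfolding c_def by (simp add: mult.assoc)
qed

theorem theorem2p3:
  fixes m :: nat and lam1 \<mu> mu1 k :: real
  assumes "lam1 > 0" "\<mu> > 0" "mu1 > 0" "\<mu> \<noteq> mu1" "k > 0"
  shows "(\<forall>lam>0. chi lam lam1 \<mu> mu1 > 1)
    \<and> (\<forall>R>0. (\<lambda>lam. legendreQ (real m - 1/2) (chi lam lam1 \<mu> mu1) * besselJ m (k * lam) * sqrt lam)
              integrable_on {0..R})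
    \<and> ((\<lambda>R. integral {0..R}
           (\<lambda>lam. legendreQ (real m - 1/2) (chi lam lam1 \<mu> mu1) * besselJ m (k * lam) * sqrt lam))
        \<longlongrightarrow> 2 * pi * sqrt (lam1 * \<mu> * mu1) * besselJ m (k * lam1)
            * besselI m (k * min \<mu> mu1) * besselK m (k * max \<mu> mu1)) at_top"
proof -
  let ?T = "\<lambda>lam. legendreQ (real m - 1/2) (chi lam lam1 \<mu> mu1) * besselJ m (k * lam) * sqrt lam"
  let ?V = "2 * pi * sqrt (lam1 * \<mu> * mu1) * besselJ m (k * lam1) * besselI m (k * min \<mu> mu1) * besselK m (k * max \<mu> mu1)"
  have "has_bochner_integral lborel (\<lambda>l. indicator {0<..} l *\<^sub>R ?T l) ?V"
    using integral_legendreQ_besselJ[OF assms, of m] by (subst (asm) has_bochner_integral_restrict_space) auto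
  \<comment> \<open>At 0 the factor \<open>sqrt l\<close> vanishes, whatever value the Legendre
    factor takes there.\<close>
  also have "(\<lambda>l. indicator {0<..} l *\<^sub>R ?T l) = (\<lambda>l. indicator {0..} l *\<^sub>R ?T l)"
    by (auto simp: indicator_def fun_eq_iff)
  finally have int: "set_integrable lborel {0..} ?T" and val: "(LINT l:{0..}|lborel. ?T l) = ?V"
    by (simp_all add: has_bochner_integral_iff set_integrable_def set_lebesgue_integral_def)
  have int_R: "set_integrable lborel {0..R} ?T" for R
    by (rule set_integrable_subset[OF int]) auto
  \<comment> \<open>Absolute integrability makes the half-line integral a limit over
    \<open>{0..R}\<close>, where the Lebesgue and Henstock-Kurzweil integrals agree.\<close>
  have "((\<lambda>R. LINT l:{0..R}|lborel. ?T l) \<longlongrightarrow> (LINT l:{0..}|lborel. ?T l)) at_top"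
    by (rule tendsto_set_lebesgue_integral_at_top[OF _ int]) auto
  then have "((\<lambda>R. integral {0..R} ?T) \<longlongrightarrow> ?V) at_top"
    unfolding val set_borel_integral_eq_integral(2)[OF int_R] .
  then show ?thesis
    using chi_gt_1 assms set_borel_integral_eq_integral(1)[OF int_R] by blast
qed

end
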